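(* Let $\mathcal{P}\subset\mathbb{R}^3$ be an affine polyhedron (not necessarily convex) with oriented planar faces $\mathcal{S}_1,\dotsc,\mathcal{S}_m$, oriented consistently with the outward orientation of $\partial\mathcal{P}$. Let $\boldsymbol{x}_0\in\mathbb{R}^3$ be any point, and for each $i$ let $\boldsymbol{x}_i$ be any point in the plane of $\mathcal{S}_i$. Let the oriented boundary of $\mathcal{S}_i$ consist of the edges with endpoint pairs $(\boldsymbol{v}_{ij1},\boldsymbol{v}_{ij2})$, $j=1,\dotsc,n_i$, ordered consistently with the orientation of the face. For $0\le\rho,\eta,t\le1$ define $$\boldsymbol{s}_{ij}(\eta,t)=\boldsymbol{x}_i+\eta\bigl[(1-t)\boldsymbol{v}_{ij1}+t\boldsymbol{v}_{ij2}-\boldsymbol{x}_i\bigr],\qquad \boldsymbol{\varphi}_{ij}(\rho,\eta,t)=\boldsymbol{x}_0+\rho\bigl(\boldsymbol{s}_{ij}(\eta,t)-\boldsymbol{x}_0\bigr),$$ and let $V_{ij}$ be the signed volume of the tetrahedron with vertices $\boldsymbol{x}_0,\boldsymbol{x}_i,\boldsymbol{v}_{ij1},\boldsymbol{v}_{ij2}$, given by $$6V_{ij}=(\boldsymbol{x}_i-\boldsymbol{x}_0)\cdot\bigl[(\boldsymbol{v}_{ij1}-\boldsymbol{x}_i)\times(\boldsymbol{v}_{ij2}-\boldsymbol{v}_{ij1})\bigr].$$ Let $f$ be a real-valued function that is smooth on an open set containing all the swept tetrahedral sectors $\boldsymbol{\varphi}_{ij}([0,1]^3)$, $1\le i\le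 m$, $1\le j\le n_i$. Then $$\int_{\mathcal{P}}f(\boldsymbol{x})\,d\boldsymbol{x}=\sum_{i=1}^{m}\sum_{j=1}^{n_i}6V_{ij}\int_0^1\int_0^1\int_0^1 f\bigl(\boldsymbol{\varphi}_{ij}(\rho,\eta,t)\bigr)\,\rho^2\eta\,dt\,d\eta\,d\rho .$$
   Context: An affine polyhedron is a compact region of $\mathbb{R}^3$ whose boundary consists of finitely many planar polygonal faces. Each face $\mathcal{S}_i$ is oriented by the outward normal of $\mathcal{P}$, and its boundary edges are directed from $\boldsymbol{v}_{ij1}$ to $\boldsymbol{v}_{ij2}$ consistently with that orientation, i.e. counterclockwise (right-hand rule) with respect to the outward normal. Neither $\mathcal{P}$ nor its faces are assumed to be convex or star-convex with respect to $\boldsymbol{x}_0$ or $\boldsymbol{x}_i$; the quantities $V_{ij}$ are signed and may be negative or zero. *)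

theory Defs
  imports "HOL-Analysis.Analysis"
begin

unbundle cross3_syntax

subsection \<open>Smooth functions\<close>

primrec times_differentiable_on :: "nat \<Rightarrow> (real^3) set \<Rightarrow> (real^3 \<Rightarrow> real) \<Rightarrow> bool" where
  "times_differentiable_on 0 U f \<longleftrightarrow> continuous_on U f"
| "times_differentiable_on (Suc k) U f \<longleftrightarrow>
     (\<forall>x\<in>U. f differentiable (at x)) \<and>
     (\<forall>v. times_differentiable_on k U (\<lambda>x. frechet_derivative f (at x) v))"

text \<open>Infinite differentiability; meant for open \<open>U\<close>, since the derivatives are taken at full
  neighbourhoods.\<close>

definition smooth_on :: "(real^3) set \<Rightarrow> (real^3 \<Rightarrow> real) \<Rightarrow> bool" where
  "smooth_on U f \<longleftrightarrow> (\<forall>k. times_differentiable_on k U f)"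

subsection \<open>Affine polyhedra with oriented faces\<close>

text \<open>A polygon is a two-dimensional region of a plane bounded by finitely many segments. It need
  be neither convex nor simply connected (holes are allowed). Since \<open>aff_dim S = 2\<close>,
  \<open>rel_interior\<close> and \<open>rel_frontier\<close> are the interior and the boundary relative to the plane
  \<open>affine hull S\<close>.\<close>

definition planar_polygon :: "(real^3) set \<Rightarrow> bool" where
  "planar_polygon S \<longleftrightarrow>
     compact S \<and> aff_dim S = 2 \<and> S = closure (rel_interior S) \<and>
     (\<exists>E. finite E \<and> rel_frontier S = (\<Union>(a, b)\<in>E. closed_segment a b))"

text \<open>The region \<open>P\<close> is the closure of its interior, and its boundary is made up of the
  polygons \<open>S 1, \<dots>, S m\<close>, which overlap at most along their boundaries.\<close>

definition affine_polyhedron :: "(real^3) set \<Rightarrow> nat \<Rightarrow> (nat \<Rightarrow> (real^3) set) \<Rightarrow> bool" where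
  "affine_polyhedron P m S \<longleftrightarrow>
     compact P \<and> P = closure (interior P) \<and>
     frontier P = (\<Union>i\<in>{1..m}. S i) \<and>
     (\<forall>i\<in>{1..m}. planar_polygon (S i)) \<and>
     (\<forall>i\<in>{1..m}. \<forall>k\<in>{1..m}. i \<noteq> k \<longrightarrow> rel_interior (S i) \<inter> rel_interior (S k) = {})"

text \<open>The unit vector \<open>\<nu>\<close> is normal to the face \<open>S i\<close> and points out of \<open>P\<close>: close to the face,
  \<open>P\<close> lies on the side of \<open>- \<nu>\<close> only. Points of other faces are left out, because the boundary of
  another face may touch \<open>S i\<close> in its relative interior.\<close>

definition outward_unit_normal ::
  "(real^3) set \<Rightarrow> nat \<Rightarrow> (nat \<Rightarrow> (real^3) set) \<Rightarrow> nat \<Rightarrow> real^3 \<Rightarrow> bool" where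
  "outward_unit_normal P m S i \<nu> \<longleftrightarrow>
     norm \<nu> = 1 \<and>
     (\<forall>p\<in>S i. \<forall>q\<in>S i. \<nu> \<bullet> (p - q) = 0) \<and>
     (\<forall>p \<in> rel_interior (S i) - (\<Union>k\<in>{1..m} - {i}. S k).
        \<forall>\<^sub>F e in at_right (0::real). p - e *\<^sub>R \<nu> \<in> P \<and> p + e *\<^sub>R \<nu> \<notin> P)"

text \<open>The boundary of the polygon \<open>S\<close>, whose plane is normal to \<open>\<nu>\<close>, consists of the directed
  edges from \<open>a j\<close> to \<open>b j\<close>, \<open>1 \<le> j \<le> n\<close>, and it is traversed counterclockwise with respect to
  \<open>\<nu>\<close>: \<open>S\<close> lies to the left of each edge, i.e. on the side of \<open>\<nu> \<times> (b j - a j)\<close>, and not to its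
  right. Points of other edges are left out, because a vertex may touch another edge.\<close>

definition oriented_boundary ::
  "(real^3) set \<Rightarrow> real^3 \<Rightarrow> nat \<Rightarrow> (nat \<Rightarrow> real^3) \<Rightarrow> (nat \<Rightarrow> real^3) \<Rightarrow> bool" where
  "oriented_boundary S \<nu> n a b \<longleftrightarrow>
     rel_frontier S = (\<Union>j\<in>{1..n}. closed_segment (a j) (b j)) \<and>
     (\<forall>j\<in>{1..n}. a j \<noteq> b j) \<and>
     (\<forall>j\<in>{1..n}. \<forall>k\<in>{1..n}. j \<noteq> k \<longrightarrow>
        open_segment (a j) (b j) \<inter> open_segment (a k) (b k) = {}) \<and>
     (\<forall>j\<in>{1..n}. \<forall>p \<in> open_segment (a j) (b j) - (\<Union>k\<in>{1..n} - {j}. closed_segment (a k) (b k)).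
        \<forall>\<^sub>F e in at_right (0::real).
          p + e *\<^sub>R (\<nu> \<times> (b j - a j)) \<in> S \<and> p - e *\<^sub>R (\<nu> \<times> (b j - a j)) \<notin> S)"

subsection \<open>Swept tetrahedral sectors\<close>

definition face_sweep :: "real^3 \<Rightarrow> real^3 \<Rightarrow> real^3 \<Rightarrow> real \<Rightarrow> real \<Rightarrow> real^3" where
  "face_sweep xi v1 v2 \<eta> t = xi + \<eta> *\<^sub>R ((1 - t) *\<^sub>R v1 + t *\<^sub>R v2 - xi)"

definition sweep ::
  "real^3 \<Rightarrow> real^3 \<Rightarrow> real^3 \<Rightarrow> real^3 \<Rightarrow> real \<Rightarrow> real \<Rightarrow> real \<Rightarrow> real^3" where
  "sweep x0 xi v1 v2 \<rho> \<eta> t = x0 + \<rho> *\<^sub>R (face_sweep xi v1 v2 \<eta> t - x0)"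

definition signed_tet_volume :: "real^3 \<Rightarrow> real^3 \<Rightarrow> real^3 \<Rightarrow> real^3 \<Rightarrow> real" where
  "signed_tet_volume x0 xi v1 v2 = ((xi - x0) \<bullet> ((v1 - xi) \<times> (v2 - v1))) / 6"

end

(* For almost every y, the indicator of P at y equals the sum of the indicators of the swept sectors,
   each weighted by the sign of its tetrahedron. To see this, follow the ray from y away from x0: it
   leaves P exactly once more than it enters if y lies in P, and equally often otherwise, and it
   crosses a face S i beyond y exactly when y lies in the cone over S i with apex x0. The same argument
   in the plane of S i, with rays away from x i, splits the indicator of S i into signed triangles. The
   exceptional points lie in the finitely many planes spanned by x0 and edges, by x0, x i and vertices,
   and by the faces. It remains to integrate f over each sector, in the coordinates of its sweep, whose
   Jacobian determinant is six times the signed volume times rho^2 eta. *)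

theory Submission
  imports Defs
begin

text \<open>The hypotheses tell on which side of a face P lies only along the normal, and only at
  relative interior points off the other faces, whereas the ray runs obliquely. The bridge is
  topological: near such a point the two open half-balls cut off by the plane of the face miss the
  boundary, so each lies wholly inside or wholly outside P, and one probe along the normal settles
  both. Phrased with affine hull and relative frontier, the argument serves P in space and a face in
  its plane alike. General position of y keeps the ray beyond y away from edges and vertices, makes
  every crossing transversal and puts y itself off the boundary. The two crossing signs, one for the
  face and one for the edge, multiply to the sign of the tetrahedron because the edge cross product
  is parallel to the face normal; that sign times the absolute Jacobian restores the signed
  volume.\<close>

section \<open>Jumps of an indicator along a ray\<close>

lemma eventually_const_unique:
  assumes "\<forall>\<^sub>F t in F. g t = a" "\<forall>\<^sub>F t in F. g t = b" "F \<noteq> bot"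
  shows "a = b"
proof -
  have "\<forall>\<^sub>F t in F. a = b"
    using assms(1,2) by eventually_elim simp
  then show ?thesis
    using assms(3) by (simp add: eventually_const)
qed

text \<open>The crossings need not be sorted: \<open>k s\<close>, the value just after
  \<open>s\<close> minus the drops \<open>J i\<close> still to come, is locally constant, hence
  constant on the connected set \<open>{1..}\<close>. Far out it is 0, and at 1 it is
  \<open>r 1\<close> minus all drops. Only one-sided values enter, so what \<open>g\<close> does at
  a crossing itself is irrelevant.\<close>

lemma jump_sum:
  fixes g :: "real \<Rightarrow> real" and \<sigma> :: "'i \<Rightarrow> real"
  assumes fin: "finite I" and \<sigma>: "\<And>i. i \<in> I \<Longrightarrow> 1 < \<sigma> i"
    and right: "\<And>s. 1 \<le> s \<Longrightarrow> \<forall>\<^sub>F t in at_right s. g t = r s"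
    and left: "\<And>s. 1 < s \<Longrightarrow> \<forall>\<^sub>F t in at_left s. g t = r s + (\<Sum>i | i \<in> I \<and> \<sigma> i = s. J i)"
    and vanish: "\<And>s. M \<le> s \<Longrightarrow> g s = 0"
  shows "r 1 = (\<Sum>i\<in>I. J i)"
proof -
  define k where "k s = r s - (\<Sum>i | i \<in> I \<and> s < \<sigma> i. J i)" for s
  have k_right: "\<forall>\<^sub>F t in at_right s. k s = k t" if s: "1 \<le> s" for s
  proof -
    obtain b where b: "b > s" "\<And>t. s < t \<Longrightarrow> t < b \<Longrightarrow> g t = r s"
      using right[OF s] by (auto simp: eventually_at_right_field)
    have "\<forall>\<^sub>F t in at_right s. \<forall>i\<in>I. s < \<sigma> i \<longrightarrow> t < \<sigma> i"
      using fin by (intro eventually_ball_finite) (auto simp: eventually_at_right_field)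
    moreover have "\<forall>\<^sub>F t in at_right s. t \<in> {s<..<b}"
      using b(1) by (rule eventually_at_right_real)
    ultimately show ?thesis
    proof eventually_elim
      case (elim t)
      have "\<forall>\<^sub>F u in at_right t. u \<in> {t<..<b}"
        using elim by (intro eventually_at_right_real) auto
      then have "\<forall>\<^sub>F u in at_right t. g u = r s"
        by eventually_elim (use elim b in auto)
      then have "r t = r s"
        using right[of t] s elim by (intro eventually_const_unique[of g _ "at_right t"]) auto
      moreover have "{i. i \<in> I \<and> t < \<sigma> i} = {i. i \<in> I \<and> s < \<sigma> i}"
        using elim by force
      ultimately show ?case
        by (simp add: k_def)
    qed
  qed
  have k_left: "\<forall>\<^sub>F t in at_left s. 1 \<le> t \<longrightarrow> k s = k t" if s: "1 < s" for s
  proof -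
    let ?J = "\<Sum>i | i \<in> I \<and> \<sigma> i = s. J i"
    obtain b where b: "b < s" "\<And>t. b < t \<Longrightarrow> t < s \<Longrightarrow> g t = r s + ?J"
      using left[OF s] by (auto simp: eventually_at_left_field)
    have "\<forall>\<^sub>F t in at_left s. \<forall>i\<in>I. \<sigma> i < s \<longrightarrow> \<sigma> i < t"
      using fin by (intro eventually_ball_finite) (auto simp: eventually_at_left_field)
    moreover have "\<forall>\<^sub>F t in at_left s. t \<in> {b<..<s}"
      using b(1) by (rule eventually_at_left_real)
    ultimately show ?thesis
    proof eventually_elim
      case (elim t)
      show ?case
      proof
        assume "1 \<le> t"
        have "\<forall>\<^sub>F u in at_right t. u \<in> {t<..<s}"
          using elim by (intro eventually_at_right_real) auto
        then have "\<forall>\<^sub>F u in at_right t. g u = r s + ?J"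
          by eventually_elim (use elim b in auto)
        then have "r t = r s + ?J"
          using right[of t] \<open>1 \<le> t\<close> by (intro eventually_const_unique[of g _ "at_right t"]) auto
        \<comment> \<open>Moving from \<open>s\<close> to a nearby \<open>t\<close> on its left adds
          to the pending crossings exactly those at \<open>s\<close>, which offsets the change of
          the right-hand value.\<close>
        moreover have "{i. i \<in> I \<and> t < \<sigma> i} = {i. i \<in> I \<and> s < \<sigma> i} \<union> {i. i \<in> I \<and> \<sigma> i = s}"
          using elim by force
        moreover have "(\<Sum>i\<in>{i. i \<in> I \<and> s < \<sigma> i} \<union> {i. i \<in> I \<and> \<sigma> i = s}. J i)
            = (\<Sum>i | i \<in> I \<and> s < \<sigma> i. J i) + ?J"
          using fin by (intro sum.union_disjoint) auto
        ultimately show "k s = k t"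
          by (simp add: k_def)
      qed
    qed
  qed
  have const: "k 1 = k s" if "1 \<le> s" for s
  proof (rule connected_local_const[where f = k and A = "{1..}"])
    show "\<forall>a\<in>{1..}. \<forall>\<^sub>F b in at a within {1..}. k a = k b"
    proof
      fix a :: real assume "a \<in> {1..}"
      have "\<forall>\<^sub>F b in at_left a. 1 \<le> b \<longrightarrow> k a = k b"
      proof (cases "a = 1")
        case True
        \<comment> \<open>Between 0 and 1 the guard \<open>1 \<le> b\<close> fails, so the endpoint
          1 imposes nothing on its left.\<close>
        then show ?thesis
          by (auto simp: eventually_at_left_field intro!: exI[of _ 0])
      next
        case False
        then show ?thesis
          using k_left[of a] \<open>a \<in> {1..}\<close> by auto
      qed
      moreover have "\<forall>\<^sub>F b in at_right a. 1 \<le> b \<longrightarrow> k a = k b"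
        using k_right[of a] \<open>a \<in> {1..}\<close> by (auto elim: eventually_mono)
      ultimately have "\<forall>\<^sub>F b in at a. 1 \<le> b \<longrightarrow> k a = k b"
        by (simp add: eventually_at_split)
      then show "\<forall>\<^sub>F b in at a within {1..}. k a = k b"
        by (auto simp: eventually_at_filter elim: eventually_mono)
    qed
  qed (use that in auto)
  define L where "L = Max (insert 1 (insert M (\<sigma> ` I)))"
  have L: "1 \<le> L" "M \<le> L" "\<And>i. i \<in> I \<Longrightarrow> \<sigma> i \<le> L"
    using fin unfolding L_def by (auto intro: Max_ge simp del: Max_insert)
  have "\<forall>\<^sub>F t in at_right L. g t = 0"
    using L by (auto simp: eventually_at_right_field intro!: exI[of _ "L + 1"] vanish)
  then have "r L = 0"
    using right[OF L(1)] by (intro eventually_const_unique[of g _ "at_right L"]) auto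
  moreover have "{i. i \<in> I \<and> L < \<sigma> i} = {}"
    using L(3) by force
  ultimately have "k L = 0"
    unfolding k_def by (simp only: sum.empty)
  moreover have "{i. i \<in> I \<and> 1 < \<sigma> i} = I"
    using \<sigma> by auto
  ultimately show ?thesis
    using const[OF L(1)] by (simp add: k_def)
qed

text \<open>Off the relative frontier, \<open>K\<close> agrees with its relative interior, which is
  open in the affine hull. So \<open>C \<inter> K\<close> is both open and closed in
  \<open>C\<close>.\<close>

lemma connected_disjoint_rel_frontier:
  fixes K :: "'a::euclidean_space set"
  assumes "closed K" "connected C" "C \<subseteq> affine hull K" "C \<inter> rel_frontier K = {}"
  shows "C \<subseteq> K \<or> C \<inter> K = {}"
proof -
  have eq: "C \<inter> K = C \<inter> rel_interior K"
    using assms(1,4) rel_interior_subset[of K] by (auto simp: rel_frontier_def)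
  have "openin (top_of_set (affine hull K)) (rel_interior K)"
    by (rule openin_rel_interior)
  then obtain T where "open T" "rel_interior K = affine hull K \<inter> T"
    by (auto simp: openin_open)
  then have "C \<inter> K = C \<inter> T"
    using eq assms(3) by auto
  then have "openin (top_of_set C) (C \<inter> K)"
    using \<open>open T\<close> by (auto simp: openin_open)
  moreover have "closedin (top_of_set C) (C \<inter> K)"
    using assms(1) by (auto simp: closedin_closed)
  ultimately show ?thesis
    using assms(2) by (auto simp: connected_clopen)
qed

lemma ball_off_closed:
  assumes "closed A" "p \<notin> A"
  obtains r where "r > 0" "ball p r \<inter> A = {}"
proof -
  have "open (- A)" "p \<in> - A"
    using assms by auto
  then obtain r where "r > 0" "ball p r \<subseteq> - A"
    by (meson openE)
  then show ?thesis
    using that by blast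
qed

text \<open>Following the ray from \<open>y\<close> away from \<open>c\<close> out to infinity, the indicator of \<open>K\<close> ends at \<open>0\<close>
  and jumps at each boundary piece it crosses, by an amount that the inward normal \<open>N j\<close> determines.\<close>

lemma ray_crossing_sum:
  fixes K :: "'a::euclidean_space set" and F :: "'i \<Rightarrow> 'a set"
  assumes K: "compact K" and J: "finite J"
    and bd: "rel_frontier K = (\<Union>j\<in>J. F j)"
    and cl: "\<And>j. j \<in> J \<Longrightarrow> closed (F j)"
    and flat: "\<And>j p q. \<lbrakk>j \<in> J; p \<in> F j; q \<in> F j\<rbrakk> \<Longrightarrow> N j \<bullet> (p - q) = 0"
    and c: "c \<in> affine hull K" and y: "y \<in> affine hull K" and "y \<noteq> c"
    and transversal: "\<And>j s. \<lbrakk>j \<in> J; 1 \<le> s; c + s *\<^sub>R (y - c) \<in> F j\<rbrakk> \<Longrightarrow> 1 < s \<and> N j \<bullet> (y - c) \<noteq> 0"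
    and single: "\<And>j k s. \<lbrakk>j \<in> J; k \<in> J; j \<noteq> k; 1 \<le> s; c + s *\<^sub>R (y - c) \<in> F j\<rbrakk> \<Longrightarrow> c + s *\<^sub>R (y - c) \<notin> F k"
    and inward: "\<And>j s. \<lbrakk>j \<in> J; 1 \<le> s; c + s *\<^sub>R (y - c) \<in> F j\<rbrakk> \<Longrightarrow>
        \<forall>\<^sub>F e in at_right 0. c + s *\<^sub>R (y - c) + e *\<^sub>R N j \<in> K \<and> c + s *\<^sub>R (y - c) - e *\<^sub>R N j \<notin> K"
  shows "of_bool (y \<in> K) = (\<Sum>j\<in>J. if \<exists>s\<ge>1. c + s *\<^sub>R (y - c) \<in> F j then - sgn (N j \<bullet> (y - c)) else 0)"
proof -
  define d where "d = y - c"
  define p where "p s = c + s *\<^sub>R d" for s :: real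
  note hits = transversal[folded d_def, folded p_def] single[folded d_def, folded p_def]
      inward[folded d_def, folded p_def]
  have p1: "p 1 = y"
    by (simp add: p_def d_def)
  have p_diff: "p t - p s = (t - s) *\<^sub>R d" for s t
    by (simp add: p_def algebra_simps)
  have p_aff: "p s \<in> affine hull K" for s
    using mem_affine[OF affine_affine_hull c y, of "1 - s" s] by (simp add: p_def d_def algebra_simps)
  have bd_sub: "rel_frontier K \<subseteq> K"
    using K by (auto simp: rel_frontier_def compact_imp_closed)
  define I where "I = {j \<in> J. \<exists>s\<ge>1. p s \<in> F j}"
  define \<sigma> where "\<sigma> j = (SOME s. 1 \<le> s \<and> p s \<in> F j)" for j
  have \<sigma>: "1 \<le> \<sigma> j \<and> p (\<sigma> j) \<in> F j" if "j \<in> I" for j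
    unfolding \<sigma>_def by (rule someI_ex) (use that in \<open>auto simp: I_def\<close>)
  \<comment> \<open>Two hits of the same flat piece at different parameters would make
    \<open>d\<close> orthogonal to \<open>N j\<close>, against transversality. Hence the parameter
    chosen for \<open>\<sigma> j\<close> is the only one.\<close>
  have I_eq: "{i. i \<in> I \<and> \<sigma> i = s} = {j \<in> J. p s \<in> F j}" if "1 \<le> s" for s
  proof -
    have "\<sigma> j = s" if "j \<in> J" "p s \<in> F j" for j
    proof -
      have "j \<in> I"
        using that \<open>1 \<le> s\<close> by (auto simp: I_def)
      then have "N j \<bullet> (p (\<sigma> j) - p s) = 0"
        using \<sigma>[of j] that flat by blast
      then show ?thesis
        using hits(1)[of j s] that \<open>1 \<le> s\<close> unfolding p_diff by simp
    qed
    then show ?thesis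
      using that \<sigma> by (auto simp: I_def)
  qed
  define g :: "real \<Rightarrow> real" where "g s = of_bool (p s \<in> K)" for s
  have near: "\<forall>\<^sub>F t in at s. p t \<in> ball (p s) e" if "e > 0" for s e
  proof -
    have "(p \<longlongrightarrow> p s) (at s)"
      unfolding p_def by (intro tendsto_intros)
    then show ?thesis
      using that by (auto simp: tendsto_iff dist_commute)
  qed
  \<comment> \<open>Off the boundary the indicator is locally constant; at a boundary point a single
    piece causes the jump. The last clause later identifies the value just after 1 with the
    indicator of \<open>y\<close> itself.\<close>
  have local: "\<exists>r. (\<forall>\<^sub>F t in at_right s. g t = r) \<and>
      (\<forall>\<^sub>F t in at_left s. g t = r + (\<Sum>i | i \<in> I \<and> \<sigma> i = s. - sgn (N i \<bullet> d)))
      \<and> (p s \<notin> rel_frontier K \<longrightarrow> r = g s)" if s: "1 \<le> s" for s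
  proof (cases "p s \<in> rel_frontier K")
    case False
    then obtain e where e: "e > 0" "ball (p s) e \<inter> rel_frontier K = {}"
      using ball_off_closed[OF closed_rel_frontier] by blast
    let ?C = "ball (p s) e \<inter> affine hull K"
    have "?C \<subseteq> K \<or> ?C \<inter> K = {}"
      using e K by (intro connected_disjoint_rel_frontier convex_connected convex_Int)
        (auto simp: compact_imp_closed affine_imp_convex)
    moreover have "p s \<in> ?C"
      using e p_aff by auto
    moreover have "p t \<in> ?C" if "p t \<in> ball (p s) e" for t
      using that p_aff by auto
    ultimately have "g t = g s" if "p t \<in> ball (p s) e" for t
      using that unfolding g_def of_bool_eq_iff by blast
    then have "\<forall>\<^sub>F t in at s. g t = g s"
      using near[OF e(1), of s] by (auto elim: eventually_mono)
    moreover have "{j \<in> J. p s \<in> F j} = {}"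
      using False bd by auto
    ultimately show ?thesis
      unfolding I_eq[OF s] by (intro exI[of _ "g s"]) (simp add: eventually_at_split del: Collect_empty_eq)
  next
    case True
    then obtain j where j: "j \<in> J" "p s \<in> F j"
      using bd by auto
    have others: "p s \<notin> F k" if "k \<in> J" "k \<noteq> j" for k
      using hits(2)[of j k s] that j s by simp
    then have set: "{j \<in> J. p s \<in> F j} = {j}"
      using j by auto
    have Nd: "N j \<bullet> d \<noteq> 0"
      using hits(1)[of j s] j s by simp
    then have "N j \<noteq> 0"
      by auto
    have "closed (\<Union>k\<in>J - {j}. F k)"
      using J cl by (intro closed_UN) auto
    moreover have "p s \<notin> (\<Union>k\<in>J - {j}. F k)"
      using others by auto
    ultimately obtain e where e: "e > 0" "ball (p s) e \<inter> (\<Union>k\<in>J - {j}. F k) = {}"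
      using ball_off_closed by blast
    \<comment> \<open>For \<open>\<epsilon>\<close> equal to 1 or -1 these are the two open
      half-balls, within the affine hull, beside the piece \<open>F j\<close>. Flatness keeps
      \<open>F j\<close> out of them and the radius keeps out the other pieces.\<close>
    define C where "C \<epsilon> = ball (p s) e \<inter> affine hull K \<inter> {z. 0 < (\<epsilon> *\<^sub>R N j) \<bullet> (z - p s)}" for \<epsilon> :: real
    have halfspace: "{z. 0 < (\<epsilon> *\<^sub>R N j) \<bullet> (z - p s)} = {z. (\<epsilon> *\<^sub>R N j) \<bullet> z > (\<epsilon> *\<^sub>R N j) \<bullet> p s}" for \<epsilon> :: real
      by (auto simp: inner_diff_right)
    have C: "C \<epsilon> \<subseteq> K \<or> C \<epsilon> \<inter> K = {}" for \<epsilon>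
    proof (intro connected_disjoint_rel_frontier convex_connected)
      show "convex (C \<epsilon>)"
        unfolding C_def halfspace
        by (intro convex_Int convex_ball affine_imp_convex affine_affine_hull convex_halfspace_gt)
      have "z \<notin> F j" if "z \<in> C \<epsilon>" for z
        using flat[OF j(1) _ j(2), of z] that by (auto simp: C_def)
      then show "C \<epsilon> \<inter> rel_frontier K = {}"
        using e bd unfolding C_def by blast
    qed (use K in \<open>auto simp: C_def compact_imp_closed\<close>)
    have "\<forall>\<^sub>F h in at_right 0. p s + h *\<^sub>R N j \<in> K \<and> p s - h *\<^sub>R N j \<notin> K"
      using hits(3)[OF j(1) s] j by simp
    moreover have "\<forall>\<^sub>F h in at_right 0. h \<in> {0<..<e / norm (N j)}"
      using \<open>N j \<noteq> 0\<close> e(1) by (intro eventually_at_right_real) auto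
    ultimately have "\<forall>\<^sub>F h in at_right 0. p s + h *\<^sub>R N j \<in> K \<and> p s - h *\<^sub>R N j \<notin> K \<and> 0 < h \<and> h * norm (N j) < e"
      by eventually_elim (use \<open>N j \<noteq> 0\<close> in \<open>auto simp: field_simps\<close>)
    \<comment> \<open>One \<open>h\<close> small enough to stay in the ball: the two probe points on
      the normal decide for each half-ball whether it is inside \<open>K\<close>.\<close>
    then obtain h where h: "p s + h *\<^sub>R N j \<in> K" "p s - h *\<^sub>R N j \<notin> K" "0 < h" "h * norm (N j) < e"
      using eventually_happens'[OF trivial_limit_at_right_real] by blast
    \<comment> \<open>The outer probe is not in \<open>K\<close>; it is in the affine hull as the
      reflection of the inner probe through \<open>p s\<close>.\<close>
    have in_aff: "p s - h *\<^sub>R N j \<in> affine hull K"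
      using mem_affine[OF affine_affine_hull p_aff[of s] hull_inc[OF h(1)], of 2 "-1"]
      by (simp add: scaleR_2 algebra_simps)
    have "p s + h *\<^sub>R N j \<in> C 1" "p s - h *\<^sub>R N j \<in> C (-1)"
      using h in_aff \<open>N j \<noteq> 0\<close> hull_inc[OF h(1)] by (auto simp: C_def dist_norm)
    then have sides: "C 1 \<subseteq> K" "C (-1) \<inter> K = {}"
      using C[of 1] C[of "-1"] h(1,2) by blast+
    \<comment> \<open>The ray need not follow the normal: the sign of
      \<open>(t - s) * (N j \<bullet> d)\<close> alone tells which half-ball holds
      \<open>p t\<close>.\<close>
    have gval: "g t = of_bool (0 < (t - s) * (N j \<bullet> d))" if "p t \<in> ball (p s) e" "t \<noteq> s" for t
    proof -
      have "(t - s) * (N j \<bullet> d) \<noteq> 0"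
        using Nd that by auto
      then have "(t - s) * (N j \<bullet> d) < 0 \<or> 0 < (t - s) * (N j \<bullet> d)"
        by linarith
      then have "p t \<in> C 1 \<and> 0 < (t - s) * (N j \<bullet> d) \<or> p t \<in> C (-1) \<and> \<not> 0 < (t - s) * (N j \<bullet> d)"
        using that(1) p_aff[of t] unfolding C_def by (auto simp: p_diff)
      then show ?thesis
        using sides unfolding g_def by (auto simp: disjoint_iff)
    qed
    have "\<forall>\<^sub>F t in at s. p t \<in> ball (p s) e"
      using near[OF e(1)] .
    then have "\<forall>\<^sub>F t in at_right s. p t \<in> ball (p s) e" "\<forall>\<^sub>F t in at_left s. p t \<in> ball (p s) e"
      by (auto simp: eventually_at_split)
    moreover have "\<forall>\<^sub>F t in at_right s. t > s" "\<forall>\<^sub>F t in at_left s. t < s"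
      by (auto simp: eventually_at_filter)
    ultimately have "\<forall>\<^sub>F t in at_right s. p t \<in> ball (p s) e \<and> t > s"
        "\<forall>\<^sub>F t in at_left s. p t \<in> ball (p s) e \<and> t < s"
      by (auto intro: eventually_conj)
    \<comment> \<open>The value after the crossing is 1 iff \<open>N j \<bullet> d\<close> is
      positive, the value before it is 1 iff it is negative; for nonzero
      \<open>N j \<bullet> d\<close> they differ by the sign.\<close>
    then have "\<forall>\<^sub>F t in at_right s. g t = of_bool (0 < N j \<bullet> d)"
        "\<forall>\<^sub>F t in at_left s. g t = of_bool (0 < N j \<bullet> d) + - sgn (N j \<bullet> d)"
      using Nd by (auto elim!: eventually_mono simp: gval zero_less_mult_iff sgn_if)
    then show ?thesis
      unfolding I_eq[OF s] set using True by auto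
  qed
  have "\<forall>s. \<exists>r. 1 \<le> s \<longrightarrow> (\<forall>\<^sub>F t in at_right s. g t = r) \<and>
      (\<forall>\<^sub>F t in at_left s. g t = r + (\<Sum>i | i \<in> I \<and> \<sigma> i = s. - sgn (N i \<bullet> d)))
      \<and> (p s \<notin> rel_frontier K \<longrightarrow> r = g s)"
    using local by blast
  from choice[OF this] obtain r where
    r: "\<And>s. 1 \<le> s \<Longrightarrow> \<forall>\<^sub>F t in at_right s. g t = r s"
      "\<And>s. 1 \<le> s \<Longrightarrow> \<forall>\<^sub>F t in at_left s. g t = r s + (\<Sum>i | i \<in> I \<and> \<sigma> i = s. - sgn (N i \<bullet> d))"
      "\<And>s. 1 \<le> s \<Longrightarrow> p s \<notin> rel_frontier K \<Longrightarrow> r s = g s"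
    by blast
  obtain B where B: "\<And>z. z \<in> K \<Longrightarrow> norm z \<le> B"
    using K compact_imp_bounded bounded_iff by metis
  have "d \<noteq> 0"
    using \<open>y \<noteq> c\<close> by (simp add: d_def)
  define M where "M = (\<bar>B\<bar> + norm c + 1) / norm d"
  have vanish: "g s = 0" if "M \<le> s" for s
  proof -
    have "\<bar>B\<bar> + norm c + 1 \<le> s * norm d"
      using that \<open>d \<noteq> 0\<close> by (simp add: M_def field_simps)
    also have "\<dots> \<le> norm (s *\<^sub>R d)"
      by (simp add: mult_right_mono)
    also have "\<dots> \<le> norm (p s) + norm c"
      using norm_triangle_ineq4[of "p s" c] by (simp add: p_def)
    finally have "p s \<notin> K"
      using B[of "p s"] by auto
    then show ?thesis
      by (simp add: g_def)
  qed
  have "1 < \<sigma> i" if "i \<in> I" for i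
    using \<sigma>[OF that] hits(1)[of i "\<sigma> i"] that by (auto simp: I_def)
  then have "r 1 = (\<Sum>i\<in>I. - sgn (N i \<bullet> d))"
    using J r(1,2) vanish by (intro jump_sum[of I \<sigma> g r _ M]) (auto simp: I_def)
  moreover have "p 1 \<notin> rel_frontier K"
    using hits(1)[of _ 1] bd by auto
  ultimately have "of_bool (y \<in> K) = (\<Sum>i\<in>I. - sgn (N i \<bullet> d))"
    using r(3)[of 1] by (simp add: g_def p1)
  also have "\<dots> = (\<Sum>j\<in>J. if \<exists>s\<ge>1. p s \<in> F j then - sgn (N j \<bullet> d) else 0)"
    using J unfolding I_def by (rule sum.inter_filter)
  finally show ?thesis
    unfolding p_def d_def .
qed

section \<open>Planes, lines and normals\<close>

text \<open>The line through \<open>c\<close> and the hit point contains \<open>q\<close>, with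
  weight \<open>1 / s\<close> on the hit point. Used in the contrapositive, it carries general
  position of \<open>q\<close> to all points of the ray.\<close>

lemma ray_affine_hull:
  assumes "c + s *\<^sub>R (q - c) \<in> affine hull A" "c \<in> affine hull A" "s \<noteq> 0"
  shows "q \<in> affine hull A"
proof -
  have "(1 - 1 / s) *\<^sub>R c + (1 / s) *\<^sub>R (c + s *\<^sub>R (q - c)) \<in> affine hull A"
    using assms by (intro mem_affine) auto
  moreover have "(1 - 1 / s) *\<^sub>R c + (1 / s) *\<^sub>R (c + s *\<^sub>R (q - c)) = q"
    using assms(3) by (simp add: algebra_simps)
  ultimately show ?thesis
    by simp
qed

text \<open>Lagrange's identity, used twice: first it shows that
  \<open>\<nu> \<times> (u \<times> v)\<close> vanishes, then it expands the double product with
  \<open>\<nu>\<close> into the claimed component minus \<open>u \<times> v\<close>.\<close>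

lemma cross_of_orthogonal:
  fixes u v \<nu> :: "real^3"
  assumes "norm \<nu> = 1" "\<nu> \<bullet> u = 0" "\<nu> \<bullet> v = 0"
  shows "u \<times> v = (\<nu> \<bullet> (u \<times> v)) *\<^sub>R \<nu>"
proof -
  have "\<nu> \<times> (u \<times> v) = 0"
    using assms by (simp add: Lagrange)
  then have "\<nu> \<times> (\<nu> \<times> (u \<times> v)) = 0"
    by simp
  then show ?thesis
    using assms(1) unfolding Lagrange[of \<nu> \<nu>] by (simp add: norm_eq_1)
qed

text \<open>Within the plane, \<open>\<nu> \<times> (b - a)\<close> is normal to the line through
  \<open>a\<close> and \<open>b\<close>. The triple product turns orthogonality to it into a
  vanishing cross product, that is, collinearity.\<close>

lemma affine_hull_pair_eqI:
  fixes a b q \<nu> :: "real^3"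
  assumes "norm \<nu> = 1" "\<nu> \<bullet> (b - a) = 0" "\<nu> \<bullet> (q - a) = 0" "(\<nu> \<times> (b - a)) \<bullet> (q - a) = 0" "a \<noteq> b"
  shows "q \<in> affine hull {a, b}"
proof -
  have "\<nu> \<bullet> ((b - a) \<times> (q - a)) = 0"
    using assms(4) cross_triple[of \<nu> "b - a" "q - a"] by (metis inner_commute)
  then have "(b - a) \<times> (q - a) = 0"
    using cross_of_orthogonal[OF assms(1-3)] by simp
  then have "collinear {b, a, q}"
    by (simp add: cross_eq_0 collinear_3)
  then have "collinear {a, b, q}"
    by (simp add: insert_commute)
  then show ?thesis
    using assms(5) by (simp add: collinear_3_affine_hull)
qed

text \<open>The hull is contained in this plane, and both have dimension 2. Membership in the hull
  thereby becomes one linear equation, based at any convenient point \<open>c\<close> of the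
  plane.\<close>

lemma affine_hull_planar_polygon:
  assumes "planar_polygon S" "norm \<nu> = 1" "\<forall>p\<in>S. \<forall>q\<in>S. \<nu> \<bullet> (p - q) = 0" "c \<in> affine hull S"
  shows "affine hull S = {z. \<nu> \<bullet> z = \<nu> \<bullet> c}"
proof -
  have dim: "aff_dim S = 2"
    using assms(1) by (simp add: planar_polygon_def)
  then have "S \<noteq> {}"
    by auto
  then obtain p where "p \<in> S"
    by blast
  have "\<nu> \<noteq> 0"
    using assms(2) by auto
  have "\<nu> \<bullet> z = \<nu> \<bullet> p" if "z \<in> S" for z
    using assms(3)[rule_format, OF that \<open>p \<in> S\<close>] by (simp add: inner_diff_right)
  then have "affine hull S \<subseteq> {z. \<nu> \<bullet> z = \<nu> \<bullet> p}"
    by (intro hull_minimal affine_hyperplane) blast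
  moreover have "aff_dim (affine hull S) = aff_dim {z. \<nu> \<bullet> z = \<nu> \<bullet> p}"
    unfolding aff_dim_affine_hull aff_dim_hyperplane[OF \<open>\<nu> \<noteq> 0\<close>] dim by simp
  ultimately have "affine hull S = {z. \<nu> \<bullet> z = \<nu> \<bullet> p}"
    using hull_inc[OF \<open>p \<in> S\<close>] by (intro affine_dim_equal affine_affine_hull affine_hyperplane) blast
  then show ?thesis
    using assms(4) by auto
qed

lemma inner_closed_segment_const:
  assumes "N \<bullet> (b - a) = 0" "p \<in> closed_segment a b"
  shows "N \<bullet> p = N \<bullet> a"
proof -
  obtain u where "p = (1 - u) *\<^sub>R a + u *\<^sub>R b"
    using assms(2) by (auto simp: in_segment)
  moreover have "N \<bullet> b = N \<bullet> a"
    using assms(1) by (simp add: inner_diff_right)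
  ultimately show ?thesis
    by (simp add: inner_add_right left_diff_distrib)
qed

section \<open>Crossing sums for a polygon and for the polyhedron\<close>

text \<open>The boundary pieces are the edges, and counterclockwise orientation makes
  \<open>\<nu> \<times> (b j - a j)\<close> an inward normal within the plane. The sign of a
  crossing is then that of the oriented triangle with apex \<open>c\<close> over the edge.\<close>

lemma planar_polygon_crossing_sum:
  assumes S: "planar_polygon S" and \<nu>: "norm \<nu> = 1" "\<forall>p\<in>S. \<forall>q\<in>S. \<nu> \<bullet> (p - q) = 0"
    and bd: "oriented_boundary S \<nu> n a b"
    and c: "c \<in> affine hull S" and q: "q \<in> affine hull S" "q \<noteq> c"
    and gen: "\<And>j. j \<in> {1..n} \<Longrightarrow> q \<notin> affine hull {c, a j} \<and> q \<notin> affine hull {c, b j} \<and> q \<notin> affine hull {a j, b j}"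
  shows "of_bool (q \<in> S) = (\<Sum>j=1..n. if \<exists>s\<ge>1. c + s *\<^sub>R (q - c) \<in> closed_segment (a j) (b j)
    then sgn (\<nu> \<bullet> ((a j - c) \<times> (b j - a j))) else 0)"
proof -
  define N where "N j = \<nu> \<times> (b j - a j)" for j
  have "compact S"
    using S by (simp add: planar_polygon_def)
  have bdU: "rel_frontier S = (\<Union>j\<in>{1..n}. closed_segment (a j) (b j))"
    and neq: "\<And>j. j \<in> {1..n} \<Longrightarrow> a j \<noteq> b j"
    and disj: "\<And>j k. j \<in> {1..n} \<Longrightarrow> k \<in> {1..n} \<Longrightarrow> j \<noteq> k \<Longrightarrow>
        open_segment (a j) (b j) \<inter> open_segment (a k) (b k) = {}"
    and inward: "\<And>j p. j \<in> {1..n} \<Longrightarrow>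
        p \<in> open_segment (a j) (b j) - (\<Union>k\<in>{1..n} - {j}. closed_segment (a k) (b k)) \<Longrightarrow>
        \<forall>\<^sub>F e in at_right 0. p + e *\<^sub>R N j \<in> S \<and> p - e *\<^sub>R N j \<notin> S"
    using bd unfolding oriented_boundary_def N_def by blast+
  have seg_S: "closed_segment (a j) (b j) \<subseteq> S" if "j \<in> {1..n}" for j
    using bdU that \<open>compact S\<close> by (auto simp: rel_frontier_def compact_imp_closed)
  have N_ortho: "N j \<bullet> (b j - a j) = 0" for j
    by (simp add: N_def dot_cross_self)
  \<comment> \<open>A hit at an endpoint would put \<open>q\<close> on a line from \<open>c\<close>
    to a vertex. In the open segments, distinct edges are disjoint and the side of \<open>S\<close>
    is known.\<close>
  have open_hit: "c + s *\<^sub>R (q - c) \<in> open_segment (a j) (b j)"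
    if "j \<in> {1..n}" "1 \<le> s" "c + s *\<^sub>R (q - c) \<in> closed_segment (a j) (b j)" for j s
  proof -
    have "c + s *\<^sub>R (q - c) \<noteq> a j" "c + s *\<^sub>R (q - c) \<noteq> b j"
      using gen[OF that(1)] ray_affine_hull[of c s q "{c, a j}"] ray_affine_hull[of c s q "{c, b j}"] that(2)
      by (auto simp: hull_inc)
    then show ?thesis
      using that(3) by (simp add: open_segment_def)
  qed
  have perp: "\<nu> \<bullet> (z - w) = 0" if "z \<in> affine hull S" "w \<in> affine hull S" for z w
    using that unfolding affine_hull_planar_polygon[OF S \<nu> c] by (simp add: inner_diff_right)
  have "of_bool (q \<in> S) = (\<Sum>j\<in>{1..n}. if \<exists>s\<ge>1. c + s *\<^sub>R (q - c) \<in> closed_segment (a j) (b j)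
      then - sgn (N j \<bullet> (q - c)) else 0)"
  proof (rule ray_crossing_sum[OF \<open>compact S\<close> _ bdU])
    show "N j \<bullet> (p - q) = 0"
      if "j \<in> {1..n}" "p \<in> closed_segment (a j) (b j)" "q \<in> closed_segment (a j) (b j)" for j p q
      using inner_closed_segment_const[OF N_ortho that(2)] inner_closed_segment_const[OF N_ortho that(3)]
      by (simp only: inner_diff_right diff_self)
    show "1 < s \<and> N j \<bullet> (q - c) \<noteq> 0"
      if j: "j \<in> {1..n}" and s: "1 \<le> s" and hit: "c + s *\<^sub>R (q - c) \<in> closed_segment (a j) (b j)" for j s
    proof
      have "a j \<in> affine hull S" "b j \<in> affine hull S"
        using seg_S[OF j] hull_subset[of S affine] by auto
      have "N j \<bullet> (q - a j) \<noteq> 0"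
        using affine_hull_pair_eqI[of \<nu> "b j" "a j" q] perp \<nu> \<open>a j \<in> _\<close> \<open>b j \<in> _\<close> q(1) gen[OF j] neq[OF j]
        by (auto simp: N_def)
      moreover have "N j \<bullet> (c + s *\<^sub>R (q - c)) = N j \<bullet> a j"
        using inner_closed_segment_const[OF N_ortho hit] .
      \<comment> \<open>The hit point is \<open>q + (s - 1) *\<^sub>R (q - c)\<close>, and its
        \<open>N j\<close> component differs from that of \<open>q\<close>. So neither factor
        vanishes, which gives both goals at once.\<close>
      ultimately have *: "(s - 1) * (N j \<bullet> (q - c)) \<noteq> 0"
        by (simp add: inner_simps algebra_simps)
      then show "N j \<bullet> (q - c) \<noteq> 0"
        by auto
      show "1 < s"
        using * s by (cases "s = 1") auto
    qed
    show "c + s *\<^sub>R (q - c) \<notin> closed_segment (a k) (b k)"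
      if "j \<in> {1..n}" "k \<in> {1..n}" "j \<noteq> k" "1 \<le> s" "c + s *\<^sub>R (q - c) \<in> closed_segment (a j) (b j)" for j k s
      using open_hit[of j s] open_hit[of k s] disj[of j k] that by blast
    then show "\<forall>\<^sub>F e in at_right 0. c + s *\<^sub>R (q - c) + e *\<^sub>R N j \<in> S \<and> c + s *\<^sub>R (q - c) - e *\<^sub>R N j \<notin> S"
      if "j \<in> {1..n}" "1 \<le> s" "c + s *\<^sub>R (q - c) \<in> closed_segment (a j) (b j)" for j s
      using open_hit[OF that] that by (intro inward) auto
  qed (use c q in auto)
  also have "\<dots> = (\<Sum>j=1..n. if \<exists>s\<ge>1. c + s *\<^sub>R (q - c) \<in> closed_segment (a j) (b j)
    then sgn (\<nu> \<bullet> ((a j - c) \<times> (b j - a j))) else 0)"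
  proof (intro sum.cong refl if_cong)
    fix j assume "\<exists>s\<ge>1. c + s *\<^sub>R (q - c) \<in> closed_segment (a j) (b j)"
    then obtain s where s: "1 \<le> s" and hit: "c + s *\<^sub>R (q - c) \<in> closed_segment (a j) (b j)"
      by blast
    \<comment> \<open>Any point of the edge has the same \<open>N j\<close> component, so the hit
      point may be traded for \<open>a j\<close>; the triple product then produces the triangle
      sign.\<close>
    have "s * (N j \<bullet> (q - c)) = N j \<bullet> (a j - c)"
      using inner_closed_segment_const[OF N_ortho hit] by (simp add: inner_simps algebra_simps)
    also have "\<dots> = - (\<nu> \<bullet> ((a j - c) \<times> (b j - a j)))"
      unfolding N_def by (simp add: cross3_simps)
    finally have "\<nu> \<bullet> ((a j - c) \<times> (b j - a j)) = - (s * (N j \<bullet> (q - c)))"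
      by simp
    then show "- sgn (N j \<bullet> (q - c)) = sgn (\<nu> \<bullet> ((a j - c) \<times> (b j - a j)))"
      using s by (simp add: sgn_mult sgn_minus)
  qed
  finally show ?thesis .
qed

lemma polyhedron_crossing_sum:
  assumes P: "affine_polyhedron P m S"
    and normal: "\<And>i. i \<in> {1..m} \<Longrightarrow> outward_unit_normal P m S i (\<nu> i)"
    and bd: "\<And>i. i \<in> {1..m} \<Longrightarrow> oriented_boundary (S i) (\<nu> i) (n i) (v1 i) (v2 i)"
    and "y \<noteq> x0"
    and off_edge: "\<And>i j. \<lbrakk>i \<in> {1..m}; j \<in> {1..n i}\<rbrakk> \<Longrightarrow> y \<notin> affine hull {x0, v1 i j, v2 i j}"
    and off_face: "\<And>i. i \<in> {1..m} \<Longrightarrow> y \<notin> affine hull S i"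
  shows "of_bool (y \<in> P) = (\<Sum>i=1..m. if \<exists>s\<ge>1. x0 + s *\<^sub>R (y - x0) \<in> S i
    then sgn (\<nu> i \<bullet> (y - x0)) else 0)"
proof -
  note P_def = P[unfolded affine_polyhedron_def]
  have "compact P"
    using P_def by (elim conjE)
  have cl: "P = closure (interior P)"
    using P_def by (elim conjE)
  have frP: "frontier P = (\<Union>i\<in>{1..m}. S i)"
    using P_def by (elim conjE)
  have "\<forall>i\<in>{1..m}. planar_polygon (S i)"
    using P_def by (elim conjE)
  then have poly: "planar_polygon (S i)" if "i \<in> {1..m}" for i
    using that by blast
  have "\<forall>i\<in>{1..m}. \<forall>k\<in>{1..m}. i \<noteq> k \<longrightarrow> rel_interior (S i) \<inter> rel_interior (S k) = {}"
    using P_def by (elim conjE)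
  then have disj: "rel_interior (S i) \<inter> rel_interior (S k) = {}" if "i \<in> {1..m}" "k \<in> {1..m}" "i \<noteq> k" for i k
    using that by blast
  show ?thesis
  proof (cases "P = {}")
    case True
    with frP have "S i = {}" if "i \<in> {1..m}" for i
      using that by auto
    then show ?thesis
      using True by simp
  next
    case False
    \<comment> \<open>A nonempty closure of an interior has interior points, so the affine hull is
      the whole space and the relative frontier is the ordinary one.\<close>
    have "interior P \<noteq> {}"
      using False cl by auto
    then have aff: "affine hull P = UNIV"
      by (rule affine_hull_nonempty_interior)
    have bdP: "rel_frontier P = (\<Union>i\<in>{1..m}. S i)"
      using frP rel_frontier_nonempty_interior[OF \<open>interior P \<noteq> {}\<close>] by simp
    have compactS: "compact (S i)" if "i \<in> {1..m}" for i
      using poly[OF that] by (simp add: planar_polygon_def)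
    have unit: "norm (\<nu> i) = 1" and flat: "\<forall>p\<in>S i. \<forall>q\<in>S i. \<nu> i \<bullet> (p - q) = 0"
      and outward: "\<forall>p \<in> rel_interior (S i) - (\<Union>k\<in>{1..m} - {i}. S k).
          \<forall>\<^sub>F e in at_right (0::real). p - e *\<^sub>R \<nu> i \<in> P \<and> p + e *\<^sub>R \<nu> i \<notin> P" if "i \<in> {1..m}" for i
      using normal[OF that] unfolding outward_unit_normal_def by blast+
    \<comment> \<open>A hit on the relative frontier of a face would put \<open>y\<close> in the
      affine hull of \<open>x0\<close> and an edge.\<close>
    have inner_hit: "x0 + s *\<^sub>R (y - x0) \<in> rel_interior (S i)"
      if i: "i \<in> {1..m}" and s: "1 \<le> s" and hit: "x0 + s *\<^sub>R (y - x0) \<in> S i" for i s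
    proof (rule ccontr)
      assume "x0 + s *\<^sub>R (y - x0) \<notin> rel_interior (S i)"
      then have "x0 + s *\<^sub>R (y - x0) \<in> rel_frontier (S i)"
        using hit closure_subset[of "S i"] by (auto simp: rel_frontier_def)
      then obtain j where j: "j \<in> {1..n i}" and "x0 + s *\<^sub>R (y - x0) \<in> closed_segment (v1 i j) (v2 i j)"
        using bd[OF i] by (auto simp: oriented_boundary_def)
      moreover have "closed_segment (v1 i j) (v2 i j) \<subseteq> affine hull {x0, v1 i j, v2 i j}"
        unfolding segment_convex_hull
        by (rule order_trans[OF convex_hull_subset_affine_hull]) (auto intro!: hull_mono)
      ultimately have "x0 + s *\<^sub>R (y - x0) \<in> affine hull {x0, v1 i j, v2 i j}"
        by blast
      then have "y \<in> affine hull {x0, v1 i j, v2 i j}"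
        using s by (intro ray_affine_hull[of x0 s y]) (auto simp: hull_inc)
      then show False
        using off_edge[OF i j] by simp
    qed
    have "of_bool (y \<in> P) = (\<Sum>i\<in>{1..m}. if \<exists>s\<ge>1. x0 + s *\<^sub>R (y - x0) \<in> S i
        then - sgn (- \<nu> i \<bullet> (y - x0)) else 0)"
    proof (rule ray_crossing_sum[OF \<open>compact P\<close> _ bdP])
      show "1 < s \<and> - \<nu> i \<bullet> (y - x0) \<noteq> 0"
        if i: "i \<in> {1..m}" and s: "1 \<le> s" and hit: "x0 + s *\<^sub>R (y - x0) \<in> S i" for i s
      proof -
        have "\<nu> i \<bullet> y \<noteq> \<nu> i \<bullet> (x0 + s *\<^sub>R (y - x0))"
          using off_face[OF i] affine_hull_planar_polygon[OF poly[OF i] unit[OF i] flat[OF i] hull_inc[OF hit]]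
          by simp
        then have *: "(s - 1) * (\<nu> i \<bullet> (y - x0)) \<noteq> 0"
          by (simp add: inner_simps algebra_simps)
        then show ?thesis
          using s by (cases "s = 1") auto
      qed
      show single: "x0 + s *\<^sub>R (y - x0) \<notin> S k"
        if "i \<in> {1..m}" "k \<in> {1..m}" "i \<noteq> k" "1 \<le> s" "x0 + s *\<^sub>R (y - x0) \<in> S i" for i k s
        using inner_hit[of i s] inner_hit[of k s] disj[of i k] that by blast
      show "\<forall>\<^sub>F e in at_right 0. x0 + s *\<^sub>R (y - x0) + e *\<^sub>R - \<nu> i \<in> P \<and> x0 + s *\<^sub>R (y - x0) - e *\<^sub>R - \<nu> i \<notin> P"
        if "i \<in> {1..m}" "1 \<le> s" "x0 + s *\<^sub>R (y - x0) \<in> S i" for i s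
      proof -
        \<comment> \<open>The outward condition speaks only of points off the other faces;
          \<open>single\<close>, a consequence of disjoint relative interiors, supplies
          this.\<close>
        have "x0 + s *\<^sub>R (y - x0) \<in> rel_interior (S i) - (\<Union>k\<in>{1..m} - {i}. S k)"
          using inner_hit[OF that] single that by blast
        then show ?thesis
          using outward[OF that(1)] by simp
      qed
    qed (use flat compactS \<open>y \<noteq> x0\<close> in \<open>auto simp: aff compact_imp_closed\<close>)
    then show ?thesis
      unfolding inner_minus_left sgn_minus minus_minus .
  qed
qed

section \<open>Membership in the swept sectors\<close>

text \<open>The parameters are packed into a cube in \<open>real^3\<close> so that the sweep maps
  \<open>real^3\<close> to itself and has a Jacobian matrix.\<close>

definition sector :: "real^3 \<Rightarrow> real^3 \<Rightarrow> real^3 \<Rightarrow> real^3 \<Rightarrow> (real^3) set" where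
  "sector x0 xi a b = (\<lambda>p. sweep x0 xi a b (p $ 1) (p $ 2) (p $ 3)) ` cbox 0 (1 :: real^3)"

lemma sector_iff:
  "y \<in> sector x0 xi a b \<longleftrightarrow> (\<exists>\<rho>\<in>{0..1}. \<exists>\<eta>\<in>{0..1}. \<exists>t\<in>{0..1}. y = sweep x0 xi a b \<rho> \<eta> t)"
proof
  assume "y \<in> sector x0 xi a b"
  then obtain p where "p \<in> cbox 0 (1 :: real^3)" "y = sweep x0 xi a b (p $ 1) (p $ 2) (p $ 3)"
    by (auto simp: sector_def)
  then show "\<exists>\<rho>\<in>{0..1}. \<exists>\<eta>\<in>{0..1}. \<exists>t\<in>{0..1}. y = sweep x0 xi a b \<rho> \<eta> t"
    by (intro bexI[of _ "p $ 1"] bexI[of _ "p $ 2"] bexI[of _ "p $ 3"]) (auto simp: mem_box_cart)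
next
  assume "\<exists>\<rho>\<in>{0..1}. \<exists>\<eta>\<in>{0..1}. \<exists>t\<in>{0..1}. y = sweep x0 xi a b \<rho> \<eta> t"
  then obtain \<rho> \<eta> t where "\<rho> \<in> {0..1}" "\<eta> \<in> {0..1}" "t \<in> {0..1}" "y = sweep x0 xi a b \<rho> \<eta> t"
    by blast
  then show "y \<in> sector x0 xi a b"
    unfolding sector_def by (intro image_eqI[of _ _ "vector [\<rho>, \<eta>, t]"]) (auto simp: mem_box_cart forall_3)
qed

text \<open>The sweep is undone by \<open>s = 1 / \<rho>\<close> and \<open>r = 1 / \<eta>\<close>.
  A zero parameter would place \<open>y\<close> at \<open>x0\<close> or on a combination of
  \<open>x0\<close> and \<open>xi\<close>, which the assumption excludes.\<close>

lemma mem_sector_iff_ray: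
  assumes y: "y \<notin> affine hull {x0, xi}"
  shows "y \<in> sector x0 xi a b \<longleftrightarrow>
    (\<exists>s\<ge>1. \<exists>r\<ge>1. xi + r *\<^sub>R (x0 + s *\<^sub>R (y - x0) - xi) \<in> closed_segment a b)"
proof
  assume "y \<in> sector x0 xi a b"
  then obtain \<rho> \<eta> t where *: "\<rho> \<in> {0..1}" "\<eta> \<in> {0..1}" "t \<in> {0..1}" "y = sweep x0 xi a b \<rho> \<eta> t"
    by (auto simp: sector_iff)
  have "\<rho> \<noteq> 0"
    using y * by (auto simp: sweep_def hull_inc)
  moreover have "\<eta> \<noteq> 0"
  proof
    assume "\<eta> = 0"
    then have "y = (1 - \<rho>) *\<^sub>R x0 + \<rho> *\<^sub>R xi"
      using * by (simp add: sweep_def face_sweep_def algebra_simps)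
    then show False
      using y mem_affine[OF affine_affine_hull, of x0 "{x0, xi}" xi "1 - \<rho>" \<rho>] by (simp add: hull_inc)
  qed
  ultimately have "xi + (1 / \<eta>) *\<^sub>R (x0 + (1 / \<rho>) *\<^sub>R (y - x0) - xi) = (1 - t) *\<^sub>R a + t *\<^sub>R b"
    by (simp add: *(4) sweep_def face_sweep_def)
  moreover have "(1 - t) *\<^sub>R a + t *\<^sub>R b \<in> closed_segment a b"
    using *(3) by (auto simp: in_segment)
  moreover have "1 \<le> 1 / \<rho>" "1 \<le> 1 / \<eta>"
    using * \<open>\<rho> \<noteq> 0\<close> \<open>\<eta> \<noteq> 0\<close> by auto
  ultimately show "\<exists>s\<ge>1. \<exists>r\<ge>1. xi + r *\<^sub>R (x0 + s *\<^sub>R (y - x0) - xi) \<in> closed_segment a b"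
    by metis
next
  assume "\<exists>s\<ge>1. \<exists>r\<ge>1. xi + r *\<^sub>R (x0 + s *\<^sub>R (y - x0) - xi) \<in> closed_segment a b"
  then obtain s r t where *: "1 \<le> s" "1 \<le> r" "0 \<le> t" "t \<le> 1"
      "xi + r *\<^sub>R (x0 + s *\<^sub>R (y - x0) - xi) = (1 - t) *\<^sub>R a + t *\<^sub>R b"
    by (auto simp: in_segment)
  have "y = sweep x0 xi a b (1 / s) (1 / r) t"
    unfolding sweep_def face_sweep_def *(5)[symmetric] using *(1,2) by simp
  then show "y \<in> sector x0 xi a b"
    using * unfolding sector_iff by (intro bexI[of _ "1 / s"] bexI[of _ "1 / r"] bexI[of _ t]) auto
qed

text \<open>The ray away from \<open>x0\<close> meets the plane of the face in at most one point
  \<open>q\<close> beyond \<open>y\<close>. Without such a point both sides vanish; otherwise the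
  planar crossing sum at \<open>q\<close>, seen from \<open>xi\<close>, is multiplied by the sign
  with which the ray crosses the face.\<close>

lemma planar_polygon_sector_sum:
  assumes S: "planar_polygon S" and \<nu>: "norm \<nu> = 1" "\<forall>p\<in>S. \<forall>q\<in>S. \<nu> \<bullet> (p - q) = 0"
    and bd: "oriented_boundary S \<nu> n a b"
    and xi: "xi \<in> affine hull S" and y: "y \<notin> affine hull S" "y \<notin> affine hull {x0, xi}"
    and gen: "\<And>j. j \<in> {1..n} \<Longrightarrow> y \<notin> affine hull {x0, xi, a j} \<and> y \<notin> affine hull {x0, xi, b j}
        \<and> y \<notin> affine hull {x0, a j, b j}"
  shows "(if \<exists>s\<ge>1. x0 + s *\<^sub>R (y - x0) \<in> S then sgn (\<nu> \<bullet> (y - x0)) else 0)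
    = (\<Sum>j=1..n. sgn (signed_tet_volume x0 xi (a j) (b j)) * of_bool (y \<in> sector x0 xi (a j) (b j)))"
proof -
  have plane: "affine hull S = {z. \<nu> \<bullet> z = \<nu> \<bullet> xi}"
    by (rule affine_hull_planar_polygon[OF S \<nu> xi])
  have seg_aff: "closed_segment (a j) (b j) \<subseteq> affine hull S" if "j \<in> {1..n}" for j
  proof -
    have "rel_frontier S \<subseteq> affine hull S"
      using closure_mono[OF hull_subset[of S affine]] closure_affine_hull[of S]
      unfolding rel_frontier_def by blast
    moreover have "rel_frontier S = (\<Union>j\<in>{1..n}. closed_segment (a j) (b j))"
      using bd unfolding oriented_boundary_def by (elim conjE)
    ultimately show ?thesis
      using that by blast
  qed
  have on_plane: "x0 + s *\<^sub>R (y - x0) \<in> affine hull S"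
    if "1 \<le> r" "j \<in> {1..n}" "xi + r *\<^sub>R (x0 + s *\<^sub>R (y - x0) - xi) \<in> closed_segment (a j) (b j)" for r s j
  proof (rule ray_affine_hull[OF _ xi])
    show "xi + r *\<^sub>R (x0 + s *\<^sub>R (y - x0) - xi) \<in> affine hull S"
      using seg_aff[OF that(2)] that(3) by blast
  qed (use that(1) in simp)
  show ?thesis
  proof (cases "\<exists>s\<ge>1. x0 + s *\<^sub>R (y - x0) \<in> affine hull S")
    case False
    then have none: "\<not> (\<exists>s\<ge>1. x0 + s *\<^sub>R (y - x0) \<in> S)"
      using hull_subset[of S affine] by blast
    have "y \<notin> sector x0 xi (a j) (b j)" if "j \<in> {1..n}" for j
    proof
      assume "y \<in> sector x0 xi (a j) (b j)"
      then obtain s r where sr: "1 \<le> s" "1 \<le> r"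
          "xi + r *\<^sub>R (x0 + s *\<^sub>R (y - x0) - xi) \<in> closed_segment (a j) (b j)"
        unfolding mem_sector_iff_ray[OF y(2)] by blast
      with on_plane[OF sr(2) that sr(3)] False show False
        by blast
    qed
    then show ?thesis
      unfolding if_not_P[OF none] by simp
  next
    case True
    then obtain s where s: "1 \<le> s" "x0 + s *\<^sub>R (y - x0) \<in> affine hull S"
      by blast
    define q where "q = x0 + s *\<^sub>R (y - x0)"
    have q: "\<nu> \<bullet> q = \<nu> \<bullet> xi"
      using s(2) plane by (simp add: q_def)
    \<comment> \<open>A ray parallel to the plane that meets it would lie in it, and so would
      \<open>y\<close>.\<close>
    have uniq: "t = s" if "x0 + t *\<^sub>R (y - x0) \<in> affine hull S" for t
    proof -
      have *: "\<nu> \<bullet> x0 + t * (\<nu> \<bullet> (y - x0)) = \<nu> \<bullet> xi" "\<nu> \<bullet> x0 + s * (\<nu> \<bullet> (y - x0)) = \<nu> \<bullet> xi"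
        using that s(2) unfolding plane by (auto simp: inner_add_right)
      then have "t * (\<nu> \<bullet> (y - x0)) = s * (\<nu> \<bullet> (y - x0))"
        by linarith
      moreover have "\<nu> \<bullet> (y - x0) \<noteq> 0"
        using y(1) * unfolding plane by (auto simp: inner_diff_right)
      ultimately show ?thesis
        by simp
    qed
    have hit_iff: "(\<exists>t\<ge>1. x0 + t *\<^sub>R (y - x0) \<in> S) \<longleftrightarrow> q \<in> S"
    proof
      assume "\<exists>t\<ge>1. x0 + t *\<^sub>R (y - x0) \<in> S"
      then obtain t where "x0 + t *\<^sub>R (y - x0) \<in> S"
        by blast
      with uniq[OF hull_inc[OF this]] show "q \<in> S"
        unfolding q_def by simp
    next
      assume "q \<in> S"
      then show "\<exists>t\<ge>1. x0 + t *\<^sub>R (y - x0) \<in> S"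
        using s(1) unfolding q_def by (intro exI[of _ s]) simp
    qed
    have sector_iff_q: "y \<in> sector x0 xi (a j) (b j) \<longleftrightarrow> (\<exists>r\<ge>1. xi + r *\<^sub>R (q - xi) \<in> closed_segment (a j) (b j))"
      if "j \<in> {1..n}" for j
    proof
      assume "y \<in> sector x0 xi (a j) (b j)"
      then obtain t r where r: "1 \<le> r" "xi + r *\<^sub>R (x0 + t *\<^sub>R (y - x0) - xi) \<in> closed_segment (a j) (b j)"
        unfolding mem_sector_iff_ray[OF y(2)] by blast
      with uniq[OF on_plane[OF r(1) that r(2)]]
      show "\<exists>r\<ge>1. xi + r *\<^sub>R (q - xi) \<in> closed_segment (a j) (b j)"
        unfolding q_def by blast
    next
      assume "\<exists>r\<ge>1. xi + r *\<^sub>R (q - xi) \<in> closed_segment (a j) (b j)"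
      then show "y \<in> sector x0 xi (a j) (b j)"
        unfolding mem_sector_iff_ray[OF y(2)] q_def using s(1) by (rule exI[of _ s, OF conjI, rotated])
    qed
    \<comment> \<open>General position descends from \<open>y\<close> to \<open>q\<close>: a hull
      containing \<open>q\<close> yields, after adjoining \<open>x0\<close>, one containing
      \<open>y\<close>.\<close>
    have off: "q \<notin> affine hull A" if "y \<notin> affine hull B" "insert x0 A \<subseteq> B" for A B
    proof
      assume "q \<in> affine hull A"
      then have "x0 + s *\<^sub>R (y - x0) \<in> affine hull B"
        using hull_mono[of A B affine] that(2) unfolding q_def by blast
      moreover have "x0 \<in> affine hull B"
        using that(2) by (intro hull_inc) blast
      ultimately show False
        using ray_affine_hull[of x0 s y B] that(1) s(1) by simp
    qed
    have gen': "q \<notin> affine hull {xi, a j} \<and> q \<notin> affine hull {xi, b j} \<and> q \<notin> affine hull {a j, b j}"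
      if "j \<in> {1..n}" for j
      using gen[OF that] by (intro conjI off[of "{x0, xi, a j}"] off[of "{x0, xi, b j}"] off[of "{x0, a j, b j}"]) simp_all
    have "q \<noteq> xi"
      using off[of "{x0, xi}" "{xi}"] y(2) by auto
    have "q \<in> affine hull S"
      using s(2) by (simp add: q_def)
    have sgn_eq: "sgn (\<nu> \<bullet> (y - x0)) = sgn (\<nu> \<bullet> (xi - x0))"
    proof -
      have "\<nu> \<bullet> (xi - x0) = s * (\<nu> \<bullet> (y - x0))"
        using q by (simp add: q_def inner_simps)
      then show ?thesis
        using s(1) by (simp add: sgn_mult)
    qed
    have crossing: "of_bool (q \<in> S) = (\<Sum>j=1..n. if \<exists>r\<ge>1. xi + r *\<^sub>R (q - xi) \<in> closed_segment (a j) (b j)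
        then sgn (\<nu> \<bullet> ((a j - xi) \<times> (b j - a j))) else 0)"
      by (rule planar_polygon_crossing_sum[OF S \<nu> bd xi \<open>q \<in> affine hull S\<close> \<open>q \<noteq> xi\<close> gen'])
    have "(if \<exists>s\<ge>1. x0 + s *\<^sub>R (y - x0) \<in> S then sgn (\<nu> \<bullet> (y - x0)) else 0)
        = sgn (\<nu> \<bullet> (xi - x0)) * of_bool (q \<in> S)"
      using hit_iff sgn_eq by simp
    also have "\<dots> = (\<Sum>j=1..n. sgn (\<nu> \<bullet> (xi - x0)) * (if \<exists>r\<ge>1. xi + r *\<^sub>R (q - xi) \<in> closed_segment (a j) (b j)
        then sgn (\<nu> \<bullet> ((a j - xi) \<times> (b j - a j))) else 0))"
      unfolding crossing sum_distrib_left ..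
    also have "\<dots> = (\<Sum>j=1..n. sgn (signed_tet_volume x0 xi (a j) (b j)) * of_bool (y \<in> sector x0 xi (a j) (b j)))"
    proof (intro sum.cong refl)
      fix j assume j: "j \<in> {1..n}"
      have "a j \<in> affine hull S" "b j \<in> affine hull S"
        using seg_aff[OF j] by auto
      \<comment> \<open>Since the cross product is a multiple of \<open>\<nu>\<close>, six times the
        signed volume factors into signed height times twice the signed triangle area.\<close>
      then have "(a j - xi) \<times> (b j - a j) = (\<nu> \<bullet> ((a j - xi) \<times> (b j - a j))) *\<^sub>R \<nu>"
        using plane by (intro cross_of_orthogonal \<nu>) (auto simp: inner_diff_right)
      then have "(xi - x0) \<bullet> ((a j - xi) \<times> (b j - a j))
          = (xi - x0) \<bullet> ((\<nu> \<bullet> ((a j - xi) \<times> (b j - a j))) *\<^sub>R \<nu>)"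
        by (rule arg_cong)
      then have "(xi - x0) \<bullet> ((a j - xi) \<times> (b j - a j))
          = (\<nu> \<bullet> (xi - x0)) * (\<nu> \<bullet> ((a j - xi) \<times> (b j - a j)))"
        unfolding inner_scaleR_right inner_commute[of _ \<nu>] by (simp only: mult.commute)
      then have "sgn (signed_tet_volume x0 xi (a j) (b j))
          = sgn (\<nu> \<bullet> (xi - x0)) * sgn (\<nu> \<bullet> ((a j - xi) \<times> (b j - a j)))"
        by (simp add: signed_tet_volume_def sgn_mult sgn_divide)
      then show "sgn (\<nu> \<bullet> (xi - x0)) * (if \<exists>r\<ge>1. xi + r *\<^sub>R (q - xi) \<in> closed_segment (a j) (b j)
          then sgn (\<nu> \<bullet> ((a j - xi) \<times> (b j - a j))) else 0)
        = sgn (signed_tet_volume x0 xi (a j) (b j)) * of_bool (y \<in> sector x0 xi (a j) (b j))"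
        using sector_iff_q[OF j] by simp
    qed
    finally show ?thesis .
  qed
qed

section \<open>Null sets and iterated integrals over the unit cube\<close>

lemma negligible_affine_hull:
  fixes A :: "'a::euclidean_space set"
  assumes "aff_dim A < DIM('a)"
  shows "negligible (affine hull A)"
  using assms by (simp add: negligible_convex_interior affine_imp_convex low_dim_interior)

lemma continuous_on_vector3 [continuous_intros]:
  fixes f g h :: "'a::topological_space \<Rightarrow> real"
  assumes "continuous_on A f" "continuous_on A g" "continuous_on A h"
  shows "continuous_on A (\<lambda>x. vector [f x, g x, h x] :: real^3)"
proof -
  have eq: "(\<lambda>x. vector [f x, g x, h x] :: real^3) = (\<lambda>x. \<chi> i. if i = 1 then f x else if i = 2 then g x else h x)"
    by (simp add: fun_eq_iff vec_eq_iff forall_3)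
  show ?thesis
    unfolding eq
  proof (rule continuous_on_vec_lambda)
    show "continuous_on A (\<lambda>x. if i = 1 then f x else if i = 2 then g x else h x)" for i :: 3
      using assms by (cases "i = 1"; cases "i = 2") simp_all
  qed
qed

text \<open>Iterated integration belongs to nested products of reals, the sweep to
  \<open>real^3\<close>. \<open>H\<close> and its inverse \<open>G\<close> match boxes with boxes of
  equal volume, so the integral is transported with factor 1.\<close>

lemma has_integral_unit_cube3:
  fixes g :: "real^3 \<Rightarrow> real"
  assumes cont: "continuous_on (cbox 0 1) g"
  shows "(g has_integral integral {0..1} (\<lambda>x. integral {0..1} (\<lambda>y. integral {0..1} (\<lambda>z. g (vector [x, y, z])))))
    (cbox 0 1)"
proof -
  define F where "F = (\<lambda>(x, y, z). g (vector [x, y, z]))"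
  define G :: "real^3 \<Rightarrow> real \<times> real \<times> real" where "G v = (v $ 1, v $ 2, v $ 3)" for v
  define H :: "real \<times> real \<times> real \<Rightarrow> real^3" where "H = (\<lambda>(x, y, z). vector [x, y, z])"
  have HG: "H (G v) = v" and GH: "G (H w) = w" for v w
    by (auto simp: G_def H_def vec_eq_iff forall_3 split: prod.splits)
  have H_image: "H ` cbox u v = cbox (H u) (H v)" for u v
  proof -
    have "w \<in> H ` cbox u v" if "w \<in> cbox (H u) (H v)" for w
    proof (rule image_eqI)
      show "w = H (G w)"
        by (simp only: HG)
      show "G w \<in> cbox u v"
        using that by (auto simp: H_def G_def cbox_Pair_eq mem_box_cart forall_3 split: prod.splits)
    qed
    then show ?thesis
      by (auto simp: H_def cbox_Pair_eq mem_box_cart forall_3 split: prod.splits)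
  qed
  have G_image: "G ` cbox u v = cbox (G u) (G v)" for u v
  proof -
    have "G ` cbox u v = G ` H ` cbox (G u) (G v)"
      unfolding H_image HG ..
    then show ?thesis
      by (simp add: image_image GH)
  qed
  have contF: "continuous_on (cbox (0, 0, 0) (1, 1, 1)) F"
    unfolding F_def case_prod_unfold
    by (intro continuous_on_compose2[OF cont] continuous_intros)
      (auto simp: cbox_Pair_eq mem_box_cart forall_3)
  have "integral (cbox (0, 0, 0) (1, 1, 1)) F
      = integral {0..1} (\<lambda>x. integral (cbox (0, 0) (1, 1)) (\<lambda>p. F (x, p)))"
    using integral_prod_continuous[OF contF] by simp
  also have "\<dots> = integral {0..1} (\<lambda>x. integral {0..1} (\<lambda>y. integral {0..1} (\<lambda>z. F (x, y, z))))"
  proof (intro integral_cong)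
    fix x :: real assume "x \<in> {0..1}"
    then have "continuous_on (cbox (0, 0) (1, 1)) (\<lambda>p. F (x, p))"
      by (intro continuous_on_compose2[OF contF] continuous_intros) (auto simp: cbox_Pair_eq)
    from integral_prod_continuous[OF this]
    show "integral (cbox (0, 0) (1, 1)) (\<lambda>p. F (x, p)) = integral {0..1} (\<lambda>y. integral {0..1} (\<lambda>z. F (x, y, z)))"
      by simp
  qed
  finally have intF: "(F has_integral integral {0..1} (\<lambda>x. integral {0..1} (\<lambda>y. integral {0..1} (\<lambda>z. F (x, y, z)))))
      (cbox (0, 0, 0) (1, 1, 1))"
    using integrable_continuous[OF contF] by (simp add: has_integral_integral)
  have "((\<lambda>v. F (G v)) has_integral
      (1 / 1) *\<^sub>R integral {0..1} (\<lambda>x. integral {0..1} (\<lambda>y. integral {0..1} (\<lambda>z. F (x, y, z)))))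
      (H ` cbox (0, 0, 0) (1, 1, 1))"
  proof (rule has_integral_twiddle[OF _ HG GH _ _ _ _ intF])
    show "isCont G v" for v
      unfolding G_def by (intro continuous_intros)
    show "measure lborel (G ` cbox u v) = 1 * measure lborel (cbox u v)" for u v :: "real^3"
    proof -
      \<comment> \<open>A reversed side counts as 0, so the product of the \<open>?L i\<close> also
        gives the volume of an empty box.\<close>
      let ?L = "\<lambda>i. if u $ i \<le> v $ i then v $ i - u $ i else 0"
      have "measure lborel (cbox u v) = (\<Prod>i\<in>UNIV. ?L i)"
      proof (cases "\<forall>i. u $ i \<le> v $ i")
        case True
        then show ?thesis
          by (simp add: content_cbox_cart interval_ne_empty_cart)
      next
        case False
        then obtain i where i: "\<not> u $ i \<le> v $ i"
          by blast
        then have "cbox u v = {}"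
          unfolding interval_eq_empty_cart not_le by blast
        moreover have "(\<Prod>i\<in>UNIV. ?L i) = 0"
          using i by (intro prod_zero) auto
        ultimately show ?thesis
          by simp
      qed
      also have "\<dots> = measure lborel (cbox (G u) (G v))"
        unfolding G_def UNIV_3 by (simp add: content_Pair content_real_if)
      finally show ?thesis
        unfolding G_image by simp
    qed
    show "\<exists>w z. G ` cbox u v = cbox w z" for u v
      using G_image by blast
    show "\<exists>w z. H ` cbox u v = cbox w z" for u v
      using H_image by blast
  qed simp
  moreover have "H (0, 0, 0) = 0" "H (1, 1, 1) = 1"
    by (auto simp: H_def vec_eq_iff forall_3)
  moreover have "F (G v) = g v" for v
    using HG[of v] by (simp add: F_def G_def H_def)
  ultimately show ?thesis
    unfolding H_image by (simp add: F_def)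
qed

section \<open>Change of variables on a sector\<close>

text \<open>The three vectors have triple product six times the signed volume, and the coefficients
  are triangular in the parameters. Injectivity and Jacobian both rest on this form.\<close>

lemma sweep_eq:
  "sweep x0 xi a b \<rho> \<eta> t = x0 + \<rho> *\<^sub>R (xi - x0) + (\<rho> * \<eta>) *\<^sub>R (a - xi) + (\<rho> * \<eta> * t) *\<^sub>R (b - a)"
  by (simp add: sweep_def face_sweep_def algebra_simps)

text \<open>Pairing with the dual vectors \<open>v \<times> w\<close>, \<open>w \<times> u\<close>
  and \<open>u \<times> v\<close> isolates one coefficient at a time.\<close>

lemma scaleR_triple_inj:
  fixes u v w :: "real^3"
  assumes "u \<bullet> (v \<times> w) \<noteq> 0"
    and "\<alpha> *\<^sub>R u + \<beta> *\<^sub>R v + \<gamma> *\<^sub>R w = \<alpha>' *\<^sub>R u + \<beta>' *\<^sub>R v + \<gamma>' *\<^sub>R w"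
  shows "\<alpha> = \<alpha>'" "\<beta> = \<beta>'" "\<gamma> = \<gamma>'"
proof -
  have uvw: "v \<bullet> (w \<times> u) = u \<bullet> (v \<times> w)" "w \<bullet> (u \<times> v) = u \<bullet> (v \<times> w)"
    by (simp_all add: cross3_simps)
  have eq: "(\<alpha> *\<^sub>R u + \<beta> *\<^sub>R v + \<gamma> *\<^sub>R w) \<bullet> z = (\<alpha>' *\<^sub>R u + \<beta>' *\<^sub>R v + \<gamma>' *\<^sub>R w) \<bullet> z" for z
    using assms(2) by simp
  show "\<alpha> = \<alpha>'"
    using eq[of "v \<times> w"] assms(1) by (simp add: inner_add_left dot_cross_self)
  show "\<beta> = \<beta>'"
    using eq[of "w \<times> u"] assms(1) by (simp add: inner_add_left dot_cross_self uvw)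
  show "\<gamma> = \<gamma>'"
    using eq[of "u \<times> v"] assms(1) by (simp add: inner_add_left dot_cross_self uvw)
qed

text \<open>By the product rule, the derivative at \<open>p\<close> in direction \<open>h\<close> of
  the map with coefficients \<open>p $ 1\<close>, \<open>p $ 1 * p $ 2\<close> and
  \<open>p $ 1 * p $ 2 * p $ 3\<close> along \<open>u\<close>, \<open>v\<close>,
  \<open>w\<close>.\<close>

definition sector_deriv :: "real^3 \<Rightarrow> real^3 \<Rightarrow> real^3 \<Rightarrow> real^3 \<Rightarrow> real^3 \<Rightarrow> real^3" where
  "sector_deriv u v w p h = (h $ 1) *\<^sub>R u + (h $ 1 * p $ 2 + p $ 1 * h $ 2) *\<^sub>R v
    + (h $ 1 * p $ 2 * p $ 3 + p $ 1 * h $ 2 * p $ 3 + p $ 1 * p $ 2 * h $ 3) *\<^sub>R w"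

lemma has_derivative_sweep:
  "((\<lambda>p. sweep x0 xi a b (p $ 1) (p $ 2) (p $ 3)) has_derivative sector_deriv (xi - x0) (a - xi) (b - a) p) (at p within A)"
proof -
  have [derivative_intros]: "((\<lambda>q::real^3. q $ i) has_derivative (\<lambda>h. h $ i)) (at p within A)" for i
    by (rule bounded_linear_imp_has_derivative[OF bounded_linear_vec_nth])
  show ?thesis
    unfolding sweep_eq sector_deriv_def
    by (auto intro!: derivative_eq_intros simp: algebra_simps)
qed

text \<open>The coefficients have a lower triangular Jacobian with diagonal 1, \<open>p $ 1\<close>,
  \<open>p $ 1 * p $ 2\<close>; the columns \<open>u\<close>, \<open>v\<close>, \<open>w\<close>
  contribute the triple product.\<close>

lemma det_sector_deriv:
  "det (matrix (sector_deriv u v w p)) = (u \<bullet> (v \<times> w)) * ((p $ 1)\<^sup>2 * p $ 2)"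
  unfolding det_3 matrix_def sector_deriv_def
  by (simp add: axis_def cross3_def inner_vec_def sum_3 algebra_simps power2_eq_square)

text \<open>Change of variables yields the absolute value of the volume; the weight
  \<open>sgn\<close> restores its sign. A flat sector has weight 0, and both sides vanish.\<close>

lemma has_integral_sector:
  fixes f :: "real^3 \<Rightarrow> real"
  assumes cont: "continuous_on (sector x0 xi a b) f"
  shows "((\<lambda>y. sgn (signed_tet_volume x0 xi a b) * (of_bool (y \<in> sector x0 xi a b) * f y)) has_integral
    6 * signed_tet_volume x0 xi a b *
      integral {0..1} (\<lambda>\<rho>. integral {0..1} (\<lambda>\<eta>. integral {0..1} (\<lambda>t.
        f (sweep x0 xi a b \<rho> \<eta> t) * \<rho>\<^sup>2 * \<eta>)))) UNIV"
    (is "(_ has_integral 6 * ?V * ?I) _")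
proof (cases "?V = 0")
  case True
  then show ?thesis
    by simp
next
  case False
  define \<phi> where "\<phi> p = sweep x0 xi a b (p $ 1) (p $ 2) (p $ 3)" for p :: "real^3"
  define \<phi>' where "\<phi>' = sector_deriv (xi - x0) (a - xi) (b - a)"
  \<comment> \<open>Where \<open>\<rho>\<close> or \<open>\<eta>\<close> is 0 the sweep collapses
    and is not injective; on the rest the coefficients can be divided out successively.\<close>
  define S where "S = cbox 0 (1 :: real^3) - {p. p $ 1 = 0} - {p. p $ 2 = 0}"
  have det6: "(xi - x0) \<bullet> ((a - xi) \<times> (b - a)) = 6 * ?V"
    by (simp add: signed_tet_volume_def)
  have der: "(\<phi> has_derivative \<phi>' p) (at p within A)" for p A
    unfolding \<phi>_def \<phi>'_def by (rule has_derivative_sweep)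
  have det: "\<bar>det (matrix (\<phi>' p))\<bar> = 6 * \<bar>?V\<bar> * ((p $ 1)\<^sup>2 * p $ 2)" if "p \<in> cbox 0 1" for p
    using that unfolding \<phi>'_def det_sector_deriv det6 by (simp add: mem_box_cart abs_mult)
  have cont_\<phi>: "continuous_on A \<phi>" for A
    using der has_derivative_continuous_on by blast
  have sector: "sector x0 xi a b = \<phi> ` cbox 0 1"
    by (simp add: sector_def \<phi>_def)
  have "continuous_on (cbox 0 1) (\<lambda>p. f (\<phi> p))"
    by (intro continuous_on_compose2[OF cont cont_\<phi>]) (simp add: sector)
  then have contD: "continuous_on (cbox 0 1) (\<lambda>p::real^3. f (\<phi> p) * (p $ 1)\<^sup>2 * p $ 2)"
    by (intro continuous_intros)
  have intI: "((\<lambda>p. f (\<phi> p) * (p $ 1)\<^sup>2 * p $ 2) has_integral ?I) (cbox 0 1)"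
    using has_integral_unit_cube3[OF contD] by (simp add: \<phi>_def)
  \<comment> \<open>The change of variables is applied to vector-valued integrands, so
    \<open>f\<close> is wrapped into \<open>real^1\<close> and read off again as its only
    component.\<close>
  have vec_linear: "bounded_linear (vec :: real \<Rightarrow> real^1)"
    unfolding linear_conv_bounded_linear[symmetric] by (rule linearI) (auto simp: vec_eq_iff)
  have eqD: "\<bar>det (matrix (\<phi>' p))\<bar> *\<^sub>R (vec (f (\<phi> p)) :: real^1)
      = vec (6 * \<bar>?V\<bar> * (f (\<phi> p) * (p $ 1)\<^sup>2 * p $ 2))" if "p \<in> cbox 0 1" for p
    using det[OF that] by (simp add: vec_eq_iff)
  have null: "negligible {p::real^3. p $ i = 0}" for i
    using negligible_hyperplane[of "axis i (1::real) :: real^3" 0] by (simp add: inner_axis')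
  have null_diff: "negligible (cbox 0 1 - S)"
    by (rule negligible_subset[OF negligible_Un[OF null[of 1] null[of 2]]]) (auto simp: S_def)
  have "S \<subseteq> cbox 0 1"
    by (auto simp: S_def)
  have "(\<lambda>p. vec (6 * \<bar>?V\<bar> * (f (\<phi> p) * (p $ 1)\<^sup>2 * p $ 2)) :: real^1) absolutely_integrable_on cbox 0 1"
    by (intro absolutely_integrable_continuous bounded_linear.continuous_on[OF vec_linear]
        continuous_on_mult[OF continuous_on_const contD])
  then have "(\<lambda>p. \<bar>det (matrix (\<phi>' p))\<bar> *\<^sub>R (vec (f (\<phi> p)) :: real^1)) absolutely_integrable_on cbox 0 1"
    by (rule absolutely_integrable_spike[OF _ negligible_empty]) (simp add: eqD)
  then have absS: "(\<lambda>p. \<bar>det (matrix (\<phi>' p))\<bar> *\<^sub>R (vec (f (\<phi> p)) :: real^1)) absolutely_integrable_on S"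
    by (rule absolutely_integrable_spike_set) (use \<open>S \<subseteq> _\<close> null_diff in \<open>auto intro: negligible_subset\<close>)
  have "((\<lambda>p. vec (6 * \<bar>?V\<bar> * (f (\<phi> p) * (p $ 1)\<^sup>2 * p $ 2)) :: real^1) has_integral vec (6 * \<bar>?V\<bar> * ?I)) (cbox 0 1)"
    using has_integral_linear[OF has_integral_mult_right[OF intI] vec_linear] by (simp add: o_def)
  then have "((\<lambda>p. \<bar>det (matrix (\<phi>' p))\<bar> *\<^sub>R (vec (f (\<phi> p)) :: real^1)) has_integral vec (6 * \<bar>?V\<bar> * ?I)) (cbox 0 1)"
    by (rule has_integral_eq[rotated]) (simp add: eqD)
  then have "((\<lambda>p. \<bar>det (matrix (\<phi>' p))\<bar> *\<^sub>R (vec (f (\<phi> p)) :: real^1)) has_integral vec (6 * \<bar>?V\<bar> * ?I)) S"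
    by (rule has_integral_spike_set_eq[THEN iffD1, rotated 2])
      (use \<open>S \<subseteq> _\<close> null_diff in \<open>auto intro: negligible_subset\<close>)
  then have intS: "integral S (\<lambda>p. \<bar>det (matrix (\<phi>' p))\<bar> *\<^sub>R (vec (f (\<phi> p)) :: real^1)) = vec (6 * \<bar>?V\<bar> * ?I)"
    by (rule integral_unique)
  have inj: "inj_on \<phi> S"
  proof (rule inj_onI)
    fix p q assume pq: "p \<in> S" "q \<in> S" "\<phi> p = \<phi> q"
    then have "(p $ 1) *\<^sub>R (xi - x0) + (p $ 1 * p $ 2) *\<^sub>R (a - xi) + (p $ 1 * p $ 2 * p $ 3) *\<^sub>R (b - a)
        = (q $ 1) *\<^sub>R (xi - x0) + (q $ 1 * q $ 2) *\<^sub>R (a - xi) + (q $ 1 * q $ 2 * q $ 3) *\<^sub>R (b - a)"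
      by (simp add: \<phi>_def sweep_eq add.assoc)
    from scaleR_triple_inj[OF _ this]
    have "p $ 1 = q $ 1" "p $ 1 * p $ 2 = q $ 1 * q $ 2" "p $ 1 * p $ 2 * p $ 3 = q $ 1 * q $ 2 * q $ 3"
      using det6 False by auto
    then show "p = q"
      using pq by (auto simp: S_def vec_eq_iff forall_3)
  qed
  have closed0: "closed {p::real^3. p $ i = 0}" for i
    by (intro closed_Collect_eq continuous_intros)
  have "S \<in> sets lebesgue"
    unfolding S_def by (intro sets.Diff) (auto simp: closed0 closed_cbox intro: sets_completionI_sets)
  from has_absolute_integral_change_of_variables[OF this der inj, of "\<lambda>y. vec (f y) :: real^1"] absS intS
  have "(\<lambda>y. vec (f y) :: real^1) absolutely_integrable_on \<phi> ` S"
      "integral (\<phi> ` S) (\<lambda>y. vec (f y) :: real^1) = vec (6 * \<bar>?V\<bar> * ?I)"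
    by blast+
  then have "((\<lambda>y. vec (f y) :: real^1) has_integral vec (6 * \<bar>?V\<bar> * ?I)) (\<phi> ` S)"
    using absolutely_integrable_on_def has_integral_integral by metis
  from has_integral_linear[OF this bounded_linear_vec_nth[of 1]]
  have int_image: "(f has_integral (6 * \<bar>?V\<bar> * ?I)) (\<phi> ` S)"
    by (simp add: o_def)
  \<comment> \<open>The collapsed part of the cube is null, and a differentiable map of
    \<open>real^3\<close> to itself keeps it null; hence the image of \<open>S\<close> may be
    replaced by the full sector.\<close>
  have "negligible (\<phi> ` (cbox 0 1 - S))"
    using null_diff der by (intro negligible_differentiable_image_negligible)
      (auto simp: differentiable_on_def differentiable_def)
  then have "negligible (\<phi> ` cbox 0 1 - \<phi> ` S)"
    by (rule negligible_subset) auto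
  then have "negligible {y \<in> \<phi> ` cbox 0 1 - \<phi> ` S. f y \<noteq> 0}"
    by (rule negligible_subset) auto
  moreover have "negligible {y \<in> \<phi> ` S - \<phi> ` cbox 0 1. f y \<noteq> 0}"
    by (rule negligible_subset[OF negligible_empty]) (use \<open>S \<subseteq> _\<close> in blast)
  ultimately have "(f has_integral (6 * \<bar>?V\<bar> * ?I)) (sector x0 xi a b)"
    unfolding sector using has_integral_spike_set_eq[THEN iffD1, OF _ _ int_image] by blast
  then have "((\<lambda>y. if y \<in> sector x0 xi a b then f y else 0) has_integral (6 * \<bar>?V\<bar> * ?I)) UNIV"
    by (simp only: has_integral_restrict_UNIV)
  moreover have "(if y \<in> sector x0 xi a b then f y else 0) = of_bool (y \<in> sector x0 xi a b) * f y" for y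
    by simp
  ultimately have *: "((\<lambda>y. of_bool (y \<in> sector x0 xi a b) * f y) has_integral (6 * \<bar>?V\<bar> * ?I)) UNIV"
    by (simp only:)
  have "sgn ?V * (6 * \<bar>?V\<bar> * ?I) = 6 * ?V * ?I"
    by (simp add: sgn_if)
  with has_integral_mult_right[OF *, of "sgn ?V"] show ?thesis
    by (simp only:)
qed

section \<open>Integration of the almost everywhere identity\<close>

lemma negligible_affine_hull_le3:
  fixes A :: "(real^3) set"
  assumes "finite A" "card A \<le> 3"
  shows "negligible (affine hull A)"
  using aff_dim_le_card[OF assms(1)] assms(2) by (intro negligible_affine_hull) simp

theorem mainTheorem2:
  fixes P :: "(real^3) set" and m :: nat and S :: "nat \<Rightarrow> (real^3) set"
    and \<nu> :: "nat \<Rightarrow> real^3"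
    and x0 :: "real^3" and x :: "nat \<Rightarrow> real^3"
    and n :: "nat \<Rightarrow> nat" and v1 v2 :: "nat \<Rightarrow> nat \<Rightarrow> real^3"
    and U :: "(real^3) set" and f :: "real^3 \<Rightarrow> real"
  assumes "affine_polyhedron P m S"
    and "\<And>i. i \<in> {1..m} \<Longrightarrow> outward_unit_normal P m S i (\<nu> i)"
    and "\<And>i. i \<in> {1..m} \<Longrightarrow> x i \<in> affine hull (S i)"
    and "\<And>i. i \<in> {1..m} \<Longrightarrow> oriented_boundary (S i) (\<nu> i) (n i) (v1 i) (v2 i)"
    and "open U"
    and "\<And>i j \<rho> \<eta> t. \<lbrakk>i \<in> {1..m}; j \<in> {1..n i}; \<rho> \<in> {0..1}; \<eta> \<in> {0..1}; t \<in> {0..1}\<rbrakk>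
           \<Longrightarrow> sweep x0 (x i) (v1 i j) (v2 i j) \<rho> \<eta> t \<in> U"
    and "smooth_on U f"
  shows "(f has_integral
           (\<Sum>i=1..m. \<Sum>j=1..n i.
              6 * signed_tet_volume x0 (x i) (v1 i j) (v2 i j) *
              integral {0..1} (\<lambda>\<rho>. integral {0..1} (\<lambda>\<eta>. integral {0..1} (\<lambda>t.
                f (sweep x0 (x i) (v1 i j) (v2 i j) \<rho> \<eta> t) * \<rho>\<^sup>2 * \<eta>))))) P"
proof -
  let ?V = "\<lambda>i j. signed_tet_volume x0 (x i) (v1 i j) (v2 i j)"
  let ?T = "\<lambda>i j. sector x0 (x i) (v1 i j) (v2 i j)"
  define E where "E i j = affine hull {x0, x i, v1 i j} \<union> affine hull {x0, x i, v2 i j}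
    \<union> affine hull {x0, v1 i j, v2 i j}" for i j
  define Z where "Z = {x0} \<union> (\<Union>i\<in>{1..m}. affine hull S i \<union> affine hull {x0, x i} \<union> (\<Union>j\<in>{1..n i}. E i j))"
  have planar: "planar_polygon (S i)" if "i \<in> {1..m}" for i
    using assms(1) that unfolding affine_polyhedron_def by (elim conjE) (rule bspec)
  have unit: "norm (\<nu> i) = 1" and flat: "\<forall>p\<in>S i. \<forall>q\<in>S i. \<nu> i \<bullet> (p - q) = 0" if "i \<in> {1..m}" for i
    using assms(2)[OF that] unfolding outward_unit_normal_def by blast+
  have "negligible (affine hull S i)" if "i \<in> {1..m}" for i
    using planar[OF that] by (intro negligible_affine_hull) (simp add: planar_polygon_def)
  \<comment> \<open>Coinciding points only lower the dimension, so \<open>x0\<close> or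
    \<open>x i\<close> may be a vertex without a separate case.\<close>
  moreover have "negligible (E i j)" for i j
    unfolding E_def by (intro negligible_Un negligible_affine_hull_le3) (simp_all add: card_insert_if)
  moreover have "negligible (affine hull {x0, x i})" for i
    by (rule negligible_affine_hull_le3) (simp_all add: card_insert_if)
  ultimately have "negligible Z"
    unfolding Z_def by (auto intro!: negligible_Union)
  have indicator: "of_bool (y \<in> P) = (\<Sum>i=1..m. \<Sum>j=1..n i. sgn (?V i j) * of_bool (y \<in> ?T i j))"
    if y: "y \<notin> Z" for y
  proof -
    have off: "y \<notin> affine hull S i" "y \<notin> affine hull {x0, x i}" if "i \<in> {1..m}" for i
      using y that unfolding Z_def by blast+
    have offE: "y \<notin> E i j" if "i \<in> {1..m}" "j \<in> {1..n i}" for i j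
      using y that unfolding Z_def by blast
    have "y \<noteq> x0"
      using y by (simp add: Z_def)
    have "of_bool (y \<in> P) = (\<Sum>i=1..m. if \<exists>s\<ge>1. x0 + s *\<^sub>R (y - x0) \<in> S i
        then sgn (\<nu> i \<bullet> (y - x0)) else 0)"
      using polyhedron_crossing_sum[OF assms(1,2,4) \<open>y \<noteq> x0\<close> _ off(1)] offE unfolding E_def by blast
    also have "\<dots> = (\<Sum>i=1..m. \<Sum>j=1..n i. sgn (?V i j) * of_bool (y \<in> ?T i j))"
    proof (intro sum.cong refl)
      fix i assume i: "i \<in> {1..m}"
      show "(if \<exists>s\<ge>1. x0 + s *\<^sub>R (y - x0) \<in> S i then sgn (\<nu> i \<bullet> (y - x0)) else 0)
          = (\<Sum>j=1..n i. sgn (?V i j) * of_bool (y \<in> ?T i j))"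
        using offE[OF i] unfolding E_def
        by (intro planar_polygon_sector_sum[OF planar[OF i] unit[OF i] flat[OF i] assms(4)[OF i] assms(3)[OF i] off[OF i]])
          blast
    qed
    finally show ?thesis .
  qed
  have "continuous_on U f"
    using assms(7)[unfolded smooth_on_def, rule_format, of 0] by simp
  moreover have "?T i j \<subseteq> U" if "i \<in> {1..m}" "j \<in> {1..n i}" for i j
    using assms(6)[OF that] by (auto simp: sector_iff)
  ultimately have cont: "continuous_on (?T i j) f" if "i \<in> {1..m}" "j \<in> {1..n i}" for i j
    using that continuous_on_subset by blast
  have "((\<lambda>y. \<Sum>i=1..m. \<Sum>j=1..n i. sgn (?V i j) * (of_bool (y \<in> ?T i j) * f y)) has_integral
      (\<Sum>i=1..m. \<Sum>j=1..n i. 6 * ?V i j *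
        integral {0..1} (\<lambda>\<rho>. integral {0..1} (\<lambda>\<eta>. integral {0..1} (\<lambda>t.
          f (sweep x0 (x i) (v1 i j) (v2 i j) \<rho> \<eta> t) * \<rho>\<^sup>2 * \<eta>))))) UNIV"
    by (intro has_integral_sum finite_atLeastAtMost has_integral_sector cont)
  then have "((\<lambda>y. if y \<in> P then f y else 0) has_integral
      (\<Sum>i=1..m. \<Sum>j=1..n i. 6 * ?V i j *
        integral {0..1} (\<lambda>\<rho>. integral {0..1} (\<lambda>\<eta>. integral {0..1} (\<lambda>t.
          f (sweep x0 (x i) (v1 i j) (v2 i j) \<rho> \<eta> t) * \<rho>\<^sup>2 * \<eta>))))) UNIV"
  \<comment> \<open>Integrability over \<open>P\<close> is a result here: off the null set
    \<open>Z\<close>, the restriction of \<open>f\<close> to \<open>P\<close> equals the signed sum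
    of its restrictions to the sectors, on each of which \<open>f\<close> is continuous.\<close>
  proof (rule has_integral_spike[OF \<open>negligible Z\<close>, rotated])
    fix y assume "y \<in> UNIV - Z"
    then have "(if y \<in> P then f y else 0) = (\<Sum>i=1..m. \<Sum>j=1..n i. sgn (?V i j) * of_bool (y \<in> ?T i j)) * f y"
      using indicator[of y] by (cases "y \<in> P") simp_all
    then show "(if y \<in> P then f y else 0) = (\<Sum>i=1..m. \<Sum>j=1..n i. sgn (?V i j) * (of_bool (y \<in> ?T i j) * f y))"
      by (simp only: sum_distrib_right mult.assoc)
  qed
  then show ?thesis
    by (simp only: has_integral_restrict_UNIV)
qed

end
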